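(* Let $p$ be a prime, let $e\geq 1$, and let $G$ be a finite abelian $p$-group with $\exp(G)=p^n$. Then there is a subgroup $\mathfrak{L}$ of $V(\mathbb{Z}_{p^e}G)$ such that $V(\mathbb{Z}_{p^e}G)=G\times \mathfrak{L}$ and \[ \mathfrak{L}\cong l\,C_{p^{e-1}}\times \Big(\times_{i=1}^{n} s_{i}\, C_{p^{i+e-1}}\Big), \] where, for $i=1,\dots,n$, the nonnegative integer $s_i$ equals \[ \big(|G^{p^{i-1}}|-2|G^{p^{i}}|+|G^{p^{i+1}}|\big)-t_i, \] with $t_i$ the number of cyclic direct factors of order $p^i$ in a decomposition of $G$ as a direct product of cyclic groups, and where $l=|G|-1-(s_1+\cdots+s_n)$. (Here $kC_m$ denotes the direct product of $k$ copies of the cyclic group $C_m$ of order $m$.)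
   Context: $\mathbb{Z}_{p^e}$ is the ring of residues modulo $p^e$; $V(\mathbb{Z}_{p^e}G)$ is the group of normalized units (units of augmentation $1$) of the group ring $\mathbb{Z}_{p^e}G$. For an abelian group $G$, $G^{p^k}=\{g^{p^k}: g\in G\}$. *)

theory Defs
  imports "HOL-Algebra.Algebra"
begin

text \<open>Elements of the group ring Z_m G are represented as functions
  carrier G -> {0..<m} (coefficients as residues), zero outside the carrier.\<close>

definition gr_elems :: "('a, 'b) monoid_scheme \<Rightarrow> nat \<Rightarrow> ('a \<Rightarrow> int) set" where
  "gr_elems G m = {f. (\<forall>x. f x \<in> {0..<int m}) \<and> (\<forall>x. x \<notin> carrier G \<longrightarrow> f x = 0)}"

definition gr_mult :: "('a, 'b) monoid_scheme \<Rightarrow> nat \<Rightarrow> ('a \<Rightarrow> int) \<Rightarrow> ('a \<Rightarrow> int) \<Rightarrow> ('a \<Rightarrow> int)" where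
  "gr_mult G m f g = (\<lambda>x. if x \<in> carrier G
      then (\<Sum>y\<in>carrier G. f y * g (inv\<^bsub>G\<^esub> y \<otimes>\<^bsub>G\<^esub> x)) mod int m else 0)"

definition gr_basis :: "('a, 'b) monoid_scheme \<Rightarrow> nat \<Rightarrow> 'a \<Rightarrow> ('a \<Rightarrow> int)" where
  "gr_basis G m g = (\<lambda>x. if x = g then 1 mod int m else 0)"

definition gr_one :: "('a, 'b) monoid_scheme \<Rightarrow> nat \<Rightarrow> ('a \<Rightarrow> int)" where
  "gr_one G m = gr_basis G m \<one>\<^bsub>G\<^esub>"

definition gr_augmentation :: "('a, 'b) monoid_scheme \<Rightarrow> nat \<Rightarrow> ('a \<Rightarrow> int) \<Rightarrow> int" where
  "gr_augmentation G m f = (\<Sum>x\<in>carrier G. f x) mod int m"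

definition gr_units :: "('a, 'b) monoid_scheme \<Rightarrow> nat \<Rightarrow> ('a \<Rightarrow> int) set" where
  "gr_units G m = {f \<in> gr_elems G m. \<exists>g \<in> gr_elems G m.
       gr_mult G m f g = gr_one G m \<and> gr_mult G m g f = gr_one G m}"

definition normalized_units :: "('a, 'b) monoid_scheme \<Rightarrow> nat \<Rightarrow> ('a \<Rightarrow> int) monoid" where
  "normalized_units G m =
     \<lparr>carrier = {f \<in> gr_units G m. gr_augmentation G m f = 1 mod int m},
      monoid.mult = gr_mult G m,
      one = gr_one G m\<rparr>"

definition group_exponent :: "('a, 'b) monoid_scheme \<Rightarrow> nat" where
  "group_exponent G = Lcm (group.ord G ` carrier G)"

definition power_subset :: "('a, 'b) monoid_scheme \<Rightarrow> nat \<Rightarrow> 'a set" where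
  "power_subset G k = {g [^]\<^bsub>G\<^esub> k | g. g \<in> carrier G}"

definition cyclic_decomposition :: "('a, 'b) monoid_scheme \<Rightarrow> 'a list \<Rightarrow> bool" where
  "cyclic_decomposition G gs \<longleftrightarrow> set gs \<subseteq> carrier G \<and>
     (\<lambda>h. finprod G h {..<length gs}) \<in>
        iso (product_group {..<length gs} (\<lambda>j. subgroup_generated G {gs ! j})) G"

definition internal_direct_product :: "('c, 'd) monoid_scheme \<Rightarrow> 'c set \<Rightarrow> 'c set \<Rightarrow> bool" where
  "internal_direct_product V A L \<longleftrightarrow> subgroup A V \<and> subgroup L V \<and>
     A \<inter> L = {\<one>\<^bsub>V\<^esub>} \<and> A <#>\<^bsub>V\<^esub> L = carrier V"

definition cyclic_product :: "nat list \<Rightarrow> (nat \<Rightarrow> int) monoid" where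
  "cyclic_product ms = product_group {..<length ms} (\<lambda>i. integer_mod_group (ms ! i))"

end

theory Submission
  imports Defs "HOL-Library.Poly_Mapping"
begin

text \<open>Let q(j) be the order of the j-th cyclic factor of G, x(j) its generator and y(j) = x(j) - 1.
  For a vector d of exponents with d(j) < q(j) let y^d be the corresponding monomial. Modulo p the units
  1 + y^d with p not dividing d form Sandling's basis of the normalized units, and those of
  total degree 1 are the generators x(j) of G. If m is least such that p^m d leaves the box
  of exponents and y^d has degree at least 2, then (1 + y^d)^(p^m) = 1 + p y^(p^(m-1) d) up
  to terms of higher degree and modulo p^2, so the p^m-th powers of these units can be completed by
  elements 1 + p y^c, where c runs through the remaining exponents, to leading terms of the
  filtration by powers of p and degree. Successive approximation shows that these units and G generate
  everything. Since the product of |G| and the orders of the generators outside G is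
  p^(e(|G|-1)), the number of normalized units, the product is direct. The calculations take place in
  the polynomial ring over the integers that maps onto the group ring.\<close>

section \<open>Filtered rings\<close>

text \<open>The degree condition comes from the relations. For q = q(j), x(j)^q = 1 says that y(j)^q
  = - p y(j)^(q/p) up to terms of higher degree and modulo p^2, so a monomial that leaves the box
  gains a factor p but loses q - q/p in degree. For y^(p^m d) to stay above the degree of p
  y^(p^(m-1) d), one needs q/p < p^(m-1) |d|. As q/p \<le> p^(m-1) d(j), equality forces d to be
  concentrated at j with d(j) a power of p, hence d(j) = 1 because p does not divide d. In that case
  the two terms really cancel, x(j)^q being 1.

  The second difference has a similar origin. The exponents d for which p^i d stays in the box
  correspond to the elements of G^(p^i), so |G^(p^(i-1))| - |G^(p^i)| of them leave at step i
  exactly. Those divisible by p are p d' with d' leaving at step i + 1, which subtracts |G^(p^i)| -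
  |G^(p^(i+1))|. Finally t_i removes the exponents of degree 1.\<close>

definition mon :: "(nat \<Rightarrow> 'r::comm_ring_1) \<Rightarrow> nat multiset \<Rightarrow> 'r" where
  "mon y d = prod_mset (image_mset y d)"

lemma mon_empty [simp]: "mon y {#} = 1"
  and mon_single [simp]: "mon y {#j#} = y j"
  and mon_add: "mon y (c + d) = mon y c * mon y d"
  by (simp_all add: mon_def)

lemma mon_repeat: "mon y (repeat_mset n d) = mon y d ^ n"
  by (induction n) (simp_all add: mon_add)

lemma mon_replicate: "mon y (replicate_mset n j) = y j ^ n"
  by (simp add: mon_def)

text \<open>In the polynomial ring below this is the N-th power of the augmentation ideal.\<close>

inductive_set aug :: "(nat \<Rightarrow> 'r::comm_ring_1) \<Rightarrow> nat \<Rightarrow> 'r set" for y N where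
  zero: "0 \<in> aug y N"
| step: "a \<in> aug y N \<Longrightarrow> N \<le> size d \<Longrightarrow> a + of_int c * mon y d \<in> aug y N"

lemma aug_add: "b \<in> aug y N \<Longrightarrow> a \<in> aug y N \<Longrightarrow> a + b \<in> aug y N"
proof (induction rule: aug.induct)
  case (step b d c)
  have "(a + b) + of_int c * mon y d \<in> aug y N"
    using step by (intro aug.step) auto
  then show ?case by (simp add: add.assoc)
qed simp

lemma aug_mon: "N \<le> size d \<Longrightarrow> mon y d \<in> aug y N"
  using aug.step[OF aug.zero, of N d 1] by simp

lemma aug_mono: "a \<in> aug y N \<Longrightarrow> M \<le> N \<Longrightarrow> a \<in> aug y M"
  by (induction rule: aug.induct) (auto intro: aug.intros)

lemma aug_of_int_mon: "N \<le> size d \<Longrightarrow> of_int c * mon y d \<in> aug y N"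
  using aug.step[OF aug.zero, of N d c] by simp

lemma aug_mult_mon: "a \<in> aug y N \<Longrightarrow> M \<le> size d \<Longrightarrow> a * (of_int c * mon y d) \<in> aug y (N + M)"
proof (induction rule: aug.induct)
  case (step a d' c')
  have "of_int (c' * c) * mon y (d' + d) \<in> aug y (N + M)"
    using step by (intro aug_of_int_mon) auto
  then have "a * (of_int c * mon y d) + of_int (c' * c) * mon y (d' + d) \<in> aug y (N + M)"
    using step by (intro aug_add) auto
  then show ?case by (simp add: mon_add algebra_simps)
qed (simp add: aug.zero)

lemma aug_mult: "b \<in> aug y M \<Longrightarrow> a \<in> aug y N \<Longrightarrow> a * b \<in> aug y (N + M)"
proof (induction rule: aug.induct)
  case (step b d c)
  then show ?case by (auto simp: ring_distribs intro!: aug_add aug_mult_mon)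
qed (simp add: aug.zero)

lemma aug_of_int [simp]: "of_int c \<in> aug y 0"
  using aug_of_int_mon[of 0 "{#}" c y] by simp

lemma aug_of_nat [simp]: "of_nat c \<in> aug y 0"
  using aug_of_int[of "int c" y] by simp

lemma aug_one [simp]: "1 \<in> aug y 0"
  using aug_of_nat[of 1 y] by simp

lemma aug_0: "a \<in> aug y N \<Longrightarrow> a \<in> aug y 0"
  by (rule aug_mono) auto

lemma aug_mult_0: "a \<in> aug y 0 \<Longrightarrow> b \<in> aug y N \<Longrightarrow> a * b \<in> aug y N"
  using aug_mult[of b y N a 0] by simp

lemma aug_mult_0': "a \<in> aug y N \<Longrightarrow> b \<in> aug y 0 \<Longrightarrow> a * b \<in> aug y N"
  using aug_mult[of b y 0 a N] by simp

lemma aug_uminus: "a \<in> aug y N \<Longrightarrow> - a \<in> aug y N"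
  using aug_mult_0[OF aug_of_int[of "-1" y], of a N] by simp

lemma aug_sum: "(\<And>i. i \<in> A \<Longrightarrow> f i \<in> aug y N) \<Longrightarrow> sum f A \<in> aug y N"
  by (induction A rule: infinite_finite_induct) (auto intro: aug_add aug.zero)

lemma aug_power: "a \<in> aug y N \<Longrightarrow> a ^ k \<in> aug y (k * N)"
proof (induction k)
  case (Suc k)
  then have "a * a ^ k \<in> aug y (N + k * N)"
    by (intro aug_mult) auto
  then show ?case by simp
qed simp

lemma aug_power_0: "a \<in> aug y 0 \<Longrightarrow> a ^ k \<in> aug y 0"
  using aug_power[of a y 0 k] by simp

lemma aug_power_pos: "a \<in> aug y N \<Longrightarrow> k > 0 \<Longrightarrow> a ^ k \<in> aug y N"
  by (rule aug_mono[OF aug_power]) auto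

lemma aug_y [simp]: "y j \<in> aug y (Suc 0)"
  using aug_mon[of 1 "{#j#}" y] by simp

section \<open>Powers of 1 + z modulo p and modulo p^2\<close>

lemma prime_power_binomial:
  assumes p: "Factorial_Ring.prime p" and z: "z \<in> aug y 0"
  obtains r where "r \<in> aug y 0" "(1 + z) ^ p = 1 + z ^ p + of_nat p * (z + z\<^sup>2 * r)"
proof -
  have p2: "p \<ge> 2" using p by (simp add: prime_ge_2_nat)
  define r where "r = (\<Sum>i\<in>{2..<p}. of_nat ((p choose i) div p) * z ^ (i - 2))"
  have "(1 + z) ^ p = (\<Sum>i\<le>p. of_nat (p choose i) * z ^ i)"
    by (subst add.commute, subst binomial_ring) simp
  also have "{..p} = insert 0 (insert 1 (insert p {2..<p}))"
    using p2 by auto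
  also have "(\<Sum>i\<in>\<dots>. of_nat (p choose i) * z ^ i)
      = 1 + z ^ p + of_nat p * z + (\<Sum>i\<in>{2..<p}. of_nat (p choose i) * z ^ i)"
    using p2 by (simp add: algebra_simps)
  also have "(\<Sum>i\<in>{2..<p}. of_nat (p choose i) * z ^ i) = of_nat p * (z\<^sup>2 * r)"
    unfolding r_def sum_distrib_left
  proof (rule sum.cong)
    fix i assume i: "i \<in> {2..<p}"
    then have "p dvd (p choose i)"
      by (intro dvd_choose_prime) (use p in auto)
    then have "of_nat (p choose i) = (of_nat p * of_nat ((p choose i) div p) :: 'a)"
      by (metis dvd_mult_div_cancel of_nat_mult)
    moreover have "z ^ i = z\<^sup>2 * z ^ (i - 2)"
      using i by (metis atLeastLessThan_iff le_add_diff_inverse power_add)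
    ultimately show "of_nat (p choose i) * z ^ i
        = of_nat p * (z\<^sup>2 * (of_nat ((p choose i) div p) * z ^ (i - 2)))"
      by (simp add: algebra_simps)
  qed simp
  finally have "(1 + z) ^ p = 1 + z ^ p + of_nat p * (z + z\<^sup>2 * r)"
    by (simp add: algebra_simps)
  moreover have "r \<in> aug y 0"
    unfolding r_def by (intro aug_sum aug_mult_0 aug_power_0 z) simp
  ultimately show ?thesis using that by blast
qed

lemma power_cong_p:
  assumes "u \<in> aug y 0" "w \<in> aug y (Suc 0)"
  obtains w' where "w' \<in> aug y (Suc 0)" "(u + of_nat p * w) ^ n = u ^ n + of_nat p * w'"
proof -
  have "\<exists>w'\<in>aug y (Suc 0). (u + of_nat p * w) ^ n = u ^ n + of_nat p * w'"
  proof (induction n)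
    case 0
    show ?case by (auto intro!: bexI[of _ 0] aug.zero)
  next
    case (Suc n)
    then obtain w' where w': "w' \<in> aug y (Suc 0)" "(u + of_nat p * w) ^ n = u ^ n + of_nat p * w'"
      by blast
    show ?case
    proof (rule bexI)
      show "(u + of_nat p * w) ^ Suc n = u ^ Suc n + of_nat p * (u * w' + w * u ^ n + of_nat p * (w * w'))"
        unfolding power_Suc w'(2) by (simp add: algebra_simps)
      show "u * w' + w * u ^ n + of_nat p * (w * w') \<in> aug y (Suc 0)"
        using assms w' by (intro aug_add aug_mult_0 aug_mult_0'[of w]) (auto intro: aug_power_0 aug_0)
    qed
  qed
  then show ?thesis using that by blast
qed

text \<open>The exponent of p improves by one because the geometric sum in the factorisation of
  v^p - u^p is itself divisible by p.\<close>

lemma prime_power_cong_p2: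
  assumes "u \<in> aug y 0" "w \<in> aug y (Suc 0)"
  obtains w' where "w' \<in> aug y (Suc 0)"
    "(u + of_nat p * w) ^ p = u ^ p + (of_nat p)\<^sup>2 * w'"
proof -
  define v where "v = u + of_nat p * w"
  have "\<exists>s\<in>aug y (Suc 0). v ^ i = u ^ i + of_nat p * s" for i
    using power_cong_p[OF assms] unfolding v_def by metis
  then obtain s where s: "\<And>i. s i \<in> aug y (Suc 0)" "\<And>i. v ^ i = u ^ i + of_nat p * s i"
    by metis
  have "v ^ p - u ^ p = (v - u) * (\<Sum>i<p. u ^ (p - Suc i) * v ^ i)"
    by (rule power_diff_sumr2)
  also have "(\<Sum>i<p. u ^ (p - Suc i) * v ^ i)
      = (\<Sum>i<p. u ^ (p - 1) + of_nat p * (u ^ (p - Suc i) * s i))"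
  proof (rule sum.cong)
    fix i assume "i \<in> {..<p}"
    then have "p - Suc i + i = p - 1" by auto
    then have "u ^ (p - Suc i) * u ^ i = u ^ (p - 1)"
      by (metis power_add)
    then show "u ^ (p - Suc i) * v ^ i = u ^ (p - 1) + of_nat p * (u ^ (p - Suc i) * s i)"
      by (simp add: s algebra_simps)
  qed simp
  also have "\<dots> = of_nat p * (u ^ (p - 1) + (\<Sum>i<p. u ^ (p - Suc i) * s i))"
    by (simp add: sum.distrib sum_distrib_left algebra_simps)
  finally have "v ^ p = u ^ p + (of_nat p)\<^sup>2 * (w * (u ^ (p - 1) + (\<Sum>i<p. u ^ (p - Suc i) * s i)))"
    by (simp add: v_def power2_eq_square algebra_simps)
  moreover have "w * (u ^ (p - 1) + (\<Sum>i<p. u ^ (p - Suc i) * s i)) \<in> aug y (Suc 0)"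
    using assms s by (intro aug_mult_0' aug_add aug_sum) (auto intro!: aug_power_0 aug_mult_0' aug_0[of "s _"])
  ultimately show ?thesis using that unfolding v_def by blast
qed

text \<open>The p-th power map is additive modulo p. What matters besides is that the error has no
  constant term, because the filtration below only admits such multiples of p.\<close>

lemma frobenius_mod_p:
  assumes p: "Factorial_Ring.prime p" and z: "z \<in> aug y (Suc 0)"
  obtains a where "a \<in> aug y (Suc 0)" "(1 + z) ^ (p ^ k) = 1 + z ^ (p ^ k) + of_nat p * a"
proof -
  have "\<exists>a\<in>aug y (Suc 0). (1 + z) ^ (p ^ k) = 1 + z ^ (p ^ k) + of_nat p * a"
  proof (induction k)
    case 0
    show ?case by (auto intro!: bexI[of _ 0] aug.zero)
  next
    case (Suc k)
    then obtain a where a: "a \<in> aug y (Suc 0)" "(1 + z) ^ (p ^ k) = 1 + z ^ (p ^ k) + of_nat p * a"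
      by blast
    define w where "w = z ^ (p ^ k)"
    have w: "w \<in> aug y (Suc 0)"
      using z p unfolding w_def by (intro aug_power_pos) (auto simp: prime_gt_0_nat)
    obtain r where r: "r \<in> aug y 0" "(1 + w) ^ p = 1 + w ^ p + of_nat p * (w + w\<^sup>2 * r)"
      using prime_power_binomial[OF p aug_0[OF w]] by blast
    obtain b where b: "b \<in> aug y (Suc 0)" "(1 + w + of_nat p * a) ^ p = (1 + w) ^ p + of_nat p * b"
      using power_cong_p[OF _ a(1), of "1 + w"] w by (metis aug_add aug_one aug_0)
    have "(1 + z) ^ (p ^ Suc k) = (1 + w + of_nat p * a) ^ p"
      by (simp add: a(2) w_def power_mult mult.commute[of p])
    also have "\<dots> = 1 + w ^ p + of_nat p * (w + w\<^sup>2 * r + b)"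
      unfolding b(2) r(2) by (simp add: algebra_simps)
    also have "w ^ p = z ^ (p ^ Suc k)"
      by (simp add: w_def mult.commute flip: power_mult)
    finally show ?case
      using w r b by (intro bexI[of _ "w + w\<^sup>2 * r + b"]) (auto intro!: aug_add aug_mult_0' aug_power_pos)
  qed
  then show ?thesis using that by blast
qed

text \<open>Splitting off the last p-th power turns the unknown error p a of the Frobenius
  congruence into a multiple of p^2. The part with a single factor p then comes from one binomial
  expansion alone, that of (1 + v)^p with v = \<open>z ^ (p ^ k)\<close>.\<close>

lemma prime_power_expansion:
  assumes p: "Factorial_Ring.prime p" and z: "z \<in> aug y (Suc 0)"
  obtains r w where "r \<in> aug y 0" "w \<in> aug y (Suc 0)"
    "(1 + z) ^ (p ^ Suc k) = 1 + z ^ (p ^ Suc k)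
       + of_nat p * (z ^ (p ^ k) + (z ^ (p ^ k))\<^sup>2 * r + of_nat p * w)"
proof -
  obtain a where a: "a \<in> aug y (Suc 0)" "(1 + z) ^ (p ^ k) = 1 + z ^ (p ^ k) + of_nat p * a"
    using frobenius_mod_p[OF p z] by blast
  define v where "v = z ^ (p ^ k)"
  have v: "v \<in> aug y (Suc 0)"
    using z p unfolding v_def by (intro aug_power_pos) (auto simp: prime_gt_0_nat)
  obtain r where r: "r \<in> aug y 0" "(1 + v) ^ p = 1 + v ^ p + of_nat p * (v + v\<^sup>2 * r)"
    using prime_power_binomial[OF p aug_0[OF v]] by blast
  obtain w where w: "w \<in> aug y (Suc 0)"
      "(1 + v + of_nat p * a) ^ p = (1 + v) ^ p + (of_nat p)\<^sup>2 * w"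
    using prime_power_cong_p2[OF _ a(1), of "1 + v"] v by (metis aug_add aug_one aug_0)
  have "(1 + z) ^ (p ^ Suc k) = (1 + v + of_nat p * a) ^ p"
    by (simp add: a(2) v_def power_mult mult.commute[of p])
  also have "\<dots> = 1 + v ^ p + of_nat p * (v + v\<^sup>2 * r + of_nat p * w)"
    unfolding w(2) r(2) by (simp add: algebra_simps power2_eq_square)
  also have "v ^ p = z ^ (p ^ Suc k)"
    by (simp add: v_def mult.commute flip: power_mult)
  finally show ?thesis
    using that r(1) w(1) unfolding v_def by blast
qed

text \<open>A multiset d of indices stands for the exponents of a monomial, and p ^ nu j is the order
  of the j-th cyclic factor. The exponents in level k are those that stay in the box after
  multiplication by p ^ k; those in gens i belong to the generators of order p ^ (i + e - 1),
  and those in extras to the generators of order p ^ (e - 1).\<close>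

definition level :: "nat \<Rightarrow> (nat \<Rightarrow> nat) \<Rightarrow> nat \<Rightarrow> nat multiset set" where
  "level p nu k = {d. \<forall>j. p ^ k * count d j < p ^ nu j}"

definition gens :: "nat \<Rightarrow> (nat \<Rightarrow> nat) \<Rightarrow> nat \<Rightarrow> nat multiset set" where
  "gens p nu i = {d \<in> level p nu (i - 1) - level p nu i. (\<exists>j. \<not> p dvd count d j) \<and> size d \<noteq> 1}"

text \<open>The exponents c for which a power of some generator 1 + y^d already has the leading term
  of 1 + p y^c. Only for the others does a generator 1 + p y^c have to be added.\<close>

definition tops :: "nat \<Rightarrow> (nat \<Rightarrow> nat) \<Rightarrow> nat multiset set" where
  "tops p nu = (\<Union>i\<in>{1..}. repeat_mset (p ^ (i - 1)) ` gens p nu i)"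

definition extras :: "nat \<Rightarrow> (nat \<Rightarrow> nat) \<Rightarrow> nat multiset set" where
  "extras p nu = level p nu 0 - {{#}} - tops p nu"

lemma repeat_div:
  assumes "p > 0" "\<forall>j. p dvd count d j"
  obtains d' where "d = repeat_mset p d'"
proof -
  have "finite {j. 0 < count d j div p}"
  proof (rule finite_subset)
    show "{j. 0 < count d j div p} \<subseteq> set_mset d"
      by (auto simp: not_in_iff intro: ccontr)
  qed simp
  then have "count (Abs_multiset (\<lambda>j. count d j div p)) j = count d j div p" for j
    by (subst count_Abs_multiset) auto
  then have "d = repeat_mset p (Abs_multiset (\<lambda>j. count d j div p))"
    using assms by (intro multiset_eqI) simp
  then show ?thesis by (rule that)
qed

text \<open>J stands for the kernel of the map from the polynomial ring to the group ring, and 1 +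
  y(j) for x(j). Where \<open>nu j = 0\<close>, the relation puts \<open>y j\<close> itself into J,
  so only finitely many variables survive although all natural numbers serve as indices.\<close>

locale presentation =
  fixes y :: "nat \<Rightarrow> 'r::comm_ring_1" and p e :: nat and nu :: "nat \<Rightarrow> nat" and J :: "'r set"
  assumes p: "Factorial_Ring.prime p" and e: "e \<ge> 1"
    and J_add: "a \<in> J \<Longrightarrow> b \<in> J \<Longrightarrow> a + b \<in> J"
    and J_mult: "a \<in> J \<Longrightarrow> r * a \<in> J"
    and J_p: "of_nat p ^ e \<in> J"
    and J_y: "(1 + y j) ^ (p ^ nu j) - 1 \<in> J"
    and fin: "finite {j. nu j \<noteq> 0}"
begin

lemma J_zero [simp]: "0 \<in> J"
  using J_mult[OF J_p, of 0] by simp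

lemma J_mult': "a \<in> J \<Longrightarrow> a * r \<in> J"
  using J_mult[of a r] by (simp add: mult.commute)

lemma J_power: "u - v \<in> J \<Longrightarrow> u ^ n - v ^ n \<in> J"
  unfolding power_diff_sumr2[of u n v] by (rule J_mult')

lemma p_gt_1: "p > 1"
  using p by (rule prime_gt_1_nat)

text \<open>With y spanning the augmentation ideal I, this is p^k (I^N + p I) + J.\<close>

definition fil :: "nat \<Rightarrow> nat \<Rightarrow> 'r set" where
  "fil k N = {of_nat p ^ k * (a + of_nat p * b) + c | a b c. a \<in> aug y N \<and> b \<in> aug y (Suc 0) \<and> c \<in> J}"

lemma filI: "a \<in> aug y N \<Longrightarrow> b \<in> aug y (Suc 0) \<Longrightarrow> c \<in> J
    \<Longrightarrow> x = of_nat p ^ k * (a + of_nat p * b) + c \<Longrightarrow> x \<in> fil k N"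
  unfolding fil_def by blast

lemma filE:
  assumes "x \<in> fil k N"
  obtains a b c where "a \<in> aug y N" "b \<in> aug y (Suc 0)" "c \<in> J"
    "x = of_nat p ^ k * (a + of_nat p * b) + c"
  using assms unfolding fil_def by blast

lemma fil_J: "c \<in> J \<Longrightarrow> c \<in> fil k N"
  by (rule filI[of 0 _ 0 c]) (auto intro: aug.zero)

lemma fil_aug: "a \<in> aug y N \<Longrightarrow> of_nat p ^ k * a \<in> fil k N"
  by (rule filI[of a _ 0 0]) (auto intro: aug.zero)

lemma fil_add: 
  assumes "x \<in> fil k N" "x' \<in> fil k N" shows "x + x' \<in> fil k N"
proof -
  obtain a b c where x: "a \<in> aug y N" "b \<in> aug y (Suc 0)" "c \<in> J"
    "x = of_nat p ^ k * (a + of_nat p * b) + c" using assms(1) by (rule filE)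
  obtain a' b' c' where x': "a' \<in> aug y N" "b' \<in> aug y (Suc 0)" "c' \<in> J"
    "x' = of_nat p ^ k * (a' + of_nat p * b') + c'" using assms(2) by (rule filE)
  show ?thesis
    by (rule filI[of "a + a'" _ "b + b'" "c + c'"])
      (use x x' in \<open>auto intro: aug_add J_add simp: algebra_simps\<close>)
qed

lemma fil_mult_aug:
  assumes "x \<in> fil k N" "r \<in> aug y M" shows "x * r \<in> fil k (N + M)"
proof -
  obtain a b c where x: "a \<in> aug y N" "b \<in> aug y (Suc 0)" "c \<in> J"
    "x = of_nat p ^ k * (a + of_nat p * b) + c" using assms(1) by (rule filE)
  show ?thesis
  proof (rule filI)
    show "a * r \<in> aug y (N + M)" using aug_mult[OF assms(2) x(1)] .
    show "b * r \<in> aug y (Suc 0)" using aug_mult_0'[OF x(2) aug_0[OF assms(2)]] .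
    show "c * r \<in> J" using J_mult'[OF x(3)] .
    show "x * r = of_nat p ^ k * (a * r + of_nat p * (b * r)) + c * r"
      unfolding x by (simp add: algebra_simps)
  qed
qed

lemma fil_mult_0: "x \<in> fil k N \<Longrightarrow> r \<in> aug y 0 \<Longrightarrow> x * r \<in> fil k N"
  using fil_mult_aug[of x k N r 0] by simp

lemma fil_mono: "x \<in> fil k N \<Longrightarrow> M \<le> N \<Longrightarrow> x \<in> fil k M"
  unfolding fil_def using aug_mono by blast

text \<open>Only the gain in degree is recorded: at \<open>k = 0\<close> there is no gain in powers
  of p.\<close>

lemma fil_mult:
  assumes "x \<in> fil k N" "x' \<in> fil k N'" shows "x * x' \<in> fil k (N + N')"
proof -
  obtain a b c where x: "a \<in> aug y N" "b \<in> aug y (Suc 0)" "c \<in> J"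
    "x = of_nat p ^ k * (a + of_nat p * b) + c" using assms(1) by (rule filE)
  obtain a' b' c' where x': "a' \<in> aug y N'" "b' \<in> aug y (Suc 0)" "c' \<in> J"
    "x' = of_nat p ^ k * (a' + of_nat p * b') + c'" using assms(2) by (rule filE)
  let ?P = "of_nat p :: 'r"
  show ?thesis
  proof (rule filI)
    show "?P ^ k * (a * a') \<in> aug y (N + N')"
      using x x' by (intro aug_mult_0 aug_mult) (auto simp flip: of_nat_power)
    show "?P ^ k * (a * b' + b * a' + ?P * (b * b')) \<in> aug y (Suc 0)"
      using aug_mult_0[OF aug_0[OF x(1)] x'(2)] aug_mult_0'[OF x(2) aug_0[OF x'(1)]]
        aug_mult_0[OF aug_0[OF x(2)] x'(2)]
      by (intro aug_mult_0[of "?P ^ k"] aug_mult_0[of ?P] aug_add)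
        (simp_all add: mult.commute flip: of_nat_power)
    show "?P ^ k * (a + ?P * b) * c' + c * x' \<in> J"
      using x x' by (intro J_add J_mult J_mult')
    show "x * x' = ?P ^ k * (?P ^ k * (a * a') + ?P * (?P ^ k * (a * b' + b * a' + ?P * (b * b'))))
        + (?P ^ k * (a + ?P * b) * c' + c * x')"
      unfolding x x' by (simp add: algebra_simps)
  qed
qed

lemma fil_mult_p: "x \<in> fil k N \<Longrightarrow> of_nat p * x \<in> fil (Suc k) N"
proof (elim filE)
  fix a b c assume "a \<in> aug y N" "b \<in> aug y (Suc 0)" "c \<in> J" "x = of_nat p ^ k * (a + of_nat p * b) + c"
  then show "of_nat p * x \<in> fil (Suc k) N"
    by (intro filI[of a _ b "of_nat p * c"] J_mult) (simp_all add: ring_distribs mult_ac)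
qed

lemma fil_e: "x \<in> fil e N \<Longrightarrow> x \<in> J"
  by (elim filE) (auto intro!: J_add J_mult' J_p)

lemma y_power_fil:
  assumes "nu j \<noteq> 0"
  shows "y j ^ (p ^ nu j) \<in> fil 1 (p ^ (nu j - 1))"
proof -
  obtain k where k: "nu j = Suc k" using assms by (cases "nu j") auto
  let ?P = "of_nat p :: 'r" and ?z = "y j ^ (p ^ k)"
  obtain r w where rw: "r \<in> aug y 0" "w \<in> aug y (Suc 0)"
    "(1 + y j) ^ (p ^ Suc k) = 1 + y j ^ (p ^ Suc k) + ?P * (?z + ?z\<^sup>2 * r + ?P * w)"
    using prime_power_expansion[OF p aug_y] by blast
  have z: "?z \<in> aug y (p ^ k)"
    using aug_power[OF aug_y, where k = "p ^ k"] by simp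
  have z2: "?z\<^sup>2 \<in> aug y (p ^ k)"
    by (intro aug_power_pos z) simp
  \<comment> \<open>The relation modulo J is solved for the pure power of \<open>y j\<close>; by the
    expansion all other terms are multiples of p.\<close>
  show ?thesis unfolding k
  proof (rule filI)
    show "- (?z + ?z\<^sup>2 * r) \<in> aug y (p ^ (Suc k - 1))"
      unfolding diff_Suc_1 using z z2 rw(1) by (intro aug_uminus aug_add aug_mult_0')
    show "- w \<in> aug y (Suc 0)" using rw by (intro aug_uminus)
    show "(1 + y j) ^ (p ^ Suc k) - 1 \<in> J" using J_y[of j] k by simp
    show "y j ^ p ^ Suc k = ?P ^ 1 * (- (?z + ?z\<^sup>2 * r) + ?P * - w) + ((1 + y j) ^ p ^ Suc k - 1)"
      unfolding rw(3) by (simp add: algebra_simps)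
  qed
qed

section \<open>Monomials outside the box and powers of the generators\<close>

lemma mon_split: "m \<le> count d j \<Longrightarrow> mon y d = y j ^ m * mon y (d - replicate_mset m j)"
  by (metis count_le_replicate_mset_subset_eq mon_add mon_replicate subset_mset.add_diff_inverse)

text \<open>One use of the j-th relation trades \<open>p ^ nu j\<close> factors \<open>y j\<close>
  for a factor p and at least \<open>p ^ (nu j - 1)\<close> factors \<open>y j\<close>; the
  remaining factors are untouched.\<close>

lemma mon_fil:
  assumes "p ^ nu j \<le> count d j" "nu j \<noteq> 0"
  shows "mon y d \<in> fil 1 (p ^ (nu j - 1) + (size d - p ^ nu j))"
proof -
  have "size (d - replicate_mset (p ^ nu j) j) = size d - p ^ nu j"
    using assms by (simp add: count_le_replicate_mset_subset_eq size_Diff_submset)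
  then show ?thesis
    unfolding mon_split[OF assms(1)]
    by (intro fil_mult_aug y_power_fil assms aug_mon) auto
qed

lemma mon_J:
  assumes "count d j \<noteq> 0" "nu j = 0"
  shows "mon y d \<in> J"
proof -
  have "y j \<in> J" using J_y[of j] assms by simp
  then show ?thesis
    using mon_split[of 1 d j] assms by (auto intro: J_mult')
qed

lemma mon_not_box:
  assumes "d \<notin> level p nu 0"
  shows "mon y d \<in> fil 1 (Suc 0)"
proof -
  obtain j where j: "p ^ nu j \<le> count d j" 
    using assms by (auto simp: level_def not_less)
  show ?thesis
  proof (cases "nu j = 0")
    case True
    then show ?thesis using j p_gt_1 mon_J[of d j] fil_J by auto
  next
    case False
    have "p ^ (nu j - 1) > 0" using p_gt_1 by simp
    then have "p ^ (nu j - 1) + (size d - p ^ nu j) \<ge> Suc 0" by linarith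
    then show ?thesis using mon_fil[OF j False] fil_mono by blast
  qed
qed

lemma repeat_level: "repeat_mset (p ^ i) d \<in> level p nu k \<longleftrightarrow> d \<in> level p nu (i + k)"
  by (simp add: level_def power_add mult_ac)

text \<open>The exponent i is the first for which \<open>p ^ i\<close> pushes d out of the box. The
  term y^(p^i d) of the expansion is therefore a multiple of p modulo J, and excluding
  \<open>size d = 1\<close> keeps it strictly above the degree of the leading term.\<close>

lemma gens_lead:
  assumes "d \<in> gens p nu i" "i \<ge> 1"
  shows "(1 + mon y d) ^ (p ^ i) - 1 - of_nat p ^ 1 * mon y (repeat_mset (p ^ (i - 1)) d)
    \<in> fil 1 (Suc (size (repeat_mset (p ^ (i - 1)) d)))"
proof -
  obtain k where k: "i = Suc k" using assms by (cases i) auto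
  let ?P = "of_nat p :: 'r" and ?z = "mon y (repeat_mset (p ^ k) d)" and ?N = "p ^ k * size d"
  have d: "d \<in> level p nu k" "d \<notin> level p nu (Suc k)" "size d \<noteq> 1"
    using assms k by (auto simp: gens_def)
  obtain j0 where j0: "\<not> p dvd count d j0" using assms by (auto simp: gens_def)
  have "d \<noteq> {#}" using j0 by auto
  then have d1: "size d \<ge> 1" by (cases "size d") auto
  have N: "?N \<ge> 1" using d1 p_gt_1 by simp
  have z: "?z \<in> aug y ?N" by (rule aug_mon) auto
  obtain r w where rw: "r \<in> aug y 0" "w \<in> aug y (Suc 0)"
    "(1 + mon y d) ^ (p ^ Suc k) = 1 + mon y d ^ (p ^ Suc k) + ?P * (?z + ?z\<^sup>2 * r + ?P * w)"
    unfolding mon_repeat using prime_power_expansion[OF p aug_mon] d1 by (metis One_nat_def)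
  have "mon y (repeat_mset (p ^ i) d) \<in> fil 1 (Suc ?N)"
  proof -
    obtain j where j: "p ^ nu j \<le> p ^ i * count d j" "p ^ k * count d j < p ^ nu j"
      using d k by (auto simp: level_def not_less)
    have cj: "count d j \<noteq> 0"
    proof
      assume "count d j = 0"
      then have "p ^ nu j \<le> 0" using j(1) by simp
      then show False using p_gt_1 by simp
    qed
    show ?thesis
    proof (cases "nu j = 0")
      case True
      then show ?thesis using j cj p_gt_1 by simp
    next
      case False
      have q: "p ^ nu j = p * p ^ (nu j - 1)" using False by (metis power_eq_if)
      have le: "p ^ (nu j - 1) \<le> p ^ k * count d j"
        using j(1) q k p_gt_1 by simp
      have cs: "count d j \<le> size d" by (rule count_le_size)
      \<comment> \<open>Equality would concentrate d at j, with a count dividing a power of p. Some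
        count of d is prime to p, so this count would be 1, contrary to the definition of
        \<open>gens\<close>.\<close>
      have "p ^ (nu j - 1) < p ^ k * size d"
      proof (rule ccontr)
        assume "\<not> ?thesis"
        then have eq: "p ^ (nu j - 1) = p ^ k * count d j" "p ^ k * size d = p ^ k * count d j"
          using le mult_le_mono2[OF cs, of "p ^ k"] by linarith+
        then have sz: "size d = count d j" using p_gt_1 by simp
        have "d = replicate_mset (count d j) j"
        proof (rule sym, rule ccontr)
          assume "replicate_mset (count d j) j \<noteq> d"
          then have "replicate_mset (count d j) j \<subset># d"
            by (simp add: subset_mset.less_le flip: count_le_replicate_mset_subset_eq)
          from mset_subset_size[OF this] show False using sz by simp
        qed
        then have "count d j0 = (if j0 = j then count d j else 0)" by (metis count_replicate_mset)
        then have "j0 = j" using j0 by (cases "j0 = j") auto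
        have "count d j dvd p ^ (nu j - 1)" using eq by simp
        then obtain l where "count d j = p ^ l"
          using p by (auto simp: divides_primepow_nat)
        with j0 \<open>j0 = j\<close> have "count d j = 1" by (cases l) auto
        then show False using d sz by simp
      qed
      \<comment> \<open>Multiplied by p - 1, the inequality compares the degree lost through the
        relation, \<open>p ^ nu j - p ^ (nu j - 1)\<close>, with the distance between the degrees of
        y^(p^i d) and y^(p^k d).\<close>
      then have "(p - 1) * p ^ (nu j - 1) < (p - 1) * (p ^ k * size d)"
        using p_gt_1 by simp
      moreover have "(p - 1) * p ^ (nu j - 1) + p ^ (nu j - 1) = p ^ nu j"
        using q p_gt_1 by (cases p) auto
      moreover have "(p - 1) * (p ^ k * size d) + p ^ k * size d = p ^ i * size d"
        using k p_gt_1 by (cases p) (auto simp: algebra_simps)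
      ultimately have "Suc ?N \<le> p ^ (nu j - 1) + (p ^ i * size d - p ^ nu j)"
        by linarith
      then show ?thesis
        using mon_fil[of j "repeat_mset (p ^ i) d"] j(1) False by (simp add: fil_mono)
    qed
  qed
  moreover have "?P * (?z\<^sup>2 * r + ?P * w) \<in> fil 1 (Suc ?N)"
  proof (rule filI)
    have "?z\<^sup>2 \<in> aug y (2 * ?N)" using aug_power[OF z] by simp
    then show "?z\<^sup>2 * r \<in> aug y (Suc ?N)"
      using N aug_mono[of _ y "2 * ?N" "Suc ?N"] by (intro aug_mult_0' rw(1)) auto
  qed (use rw in auto)
  ultimately have "mon y (repeat_mset (p ^ i) d) + ?P * (?z\<^sup>2 * r + ?P * w) \<in> fil 1 (Suc ?N)"
    by (rule fil_add)
  then show ?thesis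
    unfolding k rw(3) by (simp add: mon_repeat algebra_simps)
qed

text \<open>In the expansion of (1 + p^k w)^p the linear term dominates. The critical competitor is
  (p^k w)^p: for k = 1 and p = 2 it has no more factors p than the linear term, and only its degree,
  at least p N > N, makes it negligible.\<close>

lemma lead_power:
  assumes k: "k \<ge> 1" and N: "N \<ge> 1" and z: "z \<in> aug y N"
    and u: "u - 1 - of_nat p ^ k * z \<in> fil k (Suc N)"
  shows "u ^ p - 1 - of_nat p ^ Suc k * z \<in> fil (Suc k) (Suc N)"
proof -
  let ?P = "of_nat p :: 'r"
  obtain a b c where abc: "a \<in> aug y (Suc N)" "b \<in> aug y (Suc 0)" "c \<in> J"
    "u - 1 - ?P ^ k * z = ?P ^ k * (a + ?P * b) + c" using u by (rule filE)
  define v where "v = z + a"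
  define w where "w = v + ?P * b"
  have v: "v \<in> aug y N" unfolding v_def using z aug_mono[OF abc(1), of N] by (auto intro: aug_add)
  have v1: "v \<in> aug y (Suc 0)" using aug_mono[OF v] N by simp
  have w: "w \<in> aug y (Suc 0)" unfolding w_def
    using v1 abc(2) by (simp add: aug_add aug_mult_0)
  have u': "u = 1 + ?P ^ k * w + c"
    using abc(4) by (simp add: w_def v_def algebra_simps)
  have Pw: "?P ^ k * w \<in> aug y 0" using aug_0[OF w] by (auto intro!: aug_mult_0 simp flip: of_nat_power)
  obtain r where r: "r \<in> aug y 0"
    "(1 + ?P ^ k * w) ^ p = 1 + (?P ^ k * w) ^ p + ?P * (?P ^ k * w + (?P ^ k * w)\<^sup>2 * r)"
    using prime_power_binomial[OF p Pw] by blast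
  obtain b' where b': "b' \<in> aug y (Suc 0)" "w ^ p = v ^ p + ?P * b'"
    unfolding w_def using power_cong_p[OF aug_0[OF v] abc(2)] by blast
  \<comment> \<open>The number of factors p in (p^k w)^p beyond the k + 1 of the linear term; it can
    be 0.\<close>
  define s where "s = k * p - Suc k"
  have s: "k * p = Suc k + s" 
  proof -
    have "k * 2 \<le> k * p" using p_gt_1 by (intro mult_le_mono) auto
    then show ?thesis using k unfolding s_def by linarith
  qed
  have Pkp: "(?P ^ k * w) ^ p = ?P ^ Suc k * (?P ^ s * w ^ p)"
    unfolding power_mult_distrib power_mult[symmetric] s power_add by (simp add: mult.assoc)
  obtain k' where k': "k = Suc k'" using k by (cases k) auto
  show ?thesis
  proof (rule filI)
    show "a + ?P ^ s * v ^ p \<in> aug y (Suc N)"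
    proof -
      have "v ^ p \<in> aug y (p * N)" by (rule aug_power[OF v])
      moreover have "Suc N \<le> p * N"
      proof -
        have "2 * N \<le> p * N" using p_gt_1 by (intro mult_le_mono) auto
        then show ?thesis using N by linarith
      qed
      ultimately show ?thesis
        using abc aug_mono by (auto intro!: aug_add aug_mult_0 simp flip: of_nat_power)
    qed
    show "b + ?P ^ s * b' + ?P ^ k' * (w\<^sup>2 * r) \<in> aug y (Suc 0)"
      using abc b' w r by (auto intro!: aug_add aug_mult_0 aug_mult_0'[of "w\<^sup>2"] aug_power_pos simp flip: of_nat_power)
    show "u ^ p - (1 + ?P ^ k * w) ^ p \<in> J"
      by (rule J_power) (simp add: u' abc)
    have "u ^ p - 1 - ?P ^ Suc k * z = (1 + ?P ^ k * w) ^ p - 1 - ?P ^ Suc k * z + (u ^ p - (1 + ?P ^ k * w) ^ p)"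
      by simp
    also have "(1 + ?P ^ k * w) ^ p - 1 - ?P ^ Suc k * z
        = ?P ^ Suc k * (a + ?P ^ s * v ^ p + ?P * (b + ?P ^ s * b' + ?P ^ k' * (w\<^sup>2 * r)))"
      unfolding r(2) Pkp b'(2)
      by (simp add: k' w_def[symmetric] algebra_simps power2_eq_square) (simp add: w_def v_def algebra_simps)
    finally show "u ^ p - 1 - ?P ^ Suc k * z = ?P ^ Suc k * (a + ?P ^ s * v ^ p + ?P * (b + ?P ^ s * b' + ?P ^ k' * (w\<^sup>2 * r)))
       + (u ^ p - (1 + ?P ^ k * w) ^ p)" .
  qed
qed

lemma lead_power_iter:
  assumes k: "k \<ge> 1" and N: "N \<ge> 1" and z: "z \<in> aug y N"
    and u: "u - 1 - of_nat p ^ k * z \<in> fil k (Suc N)"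
  shows "u ^ (p ^ n) - 1 - of_nat p ^ (k + n) * z \<in> fil (k + n) (Suc N)"
proof (induction n)
  case (Suc n)
  have "(u ^ (p ^ n)) ^ p - 1 - of_nat p ^ Suc (k + n) * z \<in> fil (Suc (k + n)) (Suc N)"
    using k by (intro lead_power N z Suc) auto
  then show ?case by (simp add: mult.commute flip: power_mult)
qed (use u in simp)

lemma fil_power:
  assumes "k \<ge> 1" "u - 1 \<in> fil k (Suc 0)"
  shows "u ^ (p ^ n) - 1 \<in> fil (k + n) (Suc 0)"
proof -
  obtain a b c where abc: "a \<in> aug y (Suc 0)" "b \<in> aug y (Suc 0)" "c \<in> J"
    "u - 1 = of_nat p ^ k * (a + of_nat p * b) + c" using assms(2) by (rule filE)
  define w where "w = a + of_nat p * b"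
  have w: "w \<in> aug y (Suc 0)" unfolding w_def using abc(1,2) by (simp add: aug_add aug_mult_0)
  have "u ^ (p ^ n) - 1 - of_nat p ^ (k + n) * w \<in> fil (k + n) (Suc (Suc 0))"
    using assms w by (intro lead_power_iter) (auto simp: abc(4) w_def intro: fil_J abc)
  then have "u ^ (p ^ n) - 1 - of_nat p ^ (k + n) * w + of_nat p ^ (k + n) * w \<in> fil (k + n) (Suc 0)"
    using w by (intro fil_add fil_aug) (auto dest: fil_mono[where M = "Suc 0"])
  then show ?thesis by simp
qed

text \<open>Each p-th power gains a factor p, and p^e vanishes modulo J. Starting with one factor p
  leaves e - 1 steps.\<close>

lemma fil_1_order:
  assumes "u - 1 \<in> fil 1 (Suc 0)"
  shows "u ^ (p ^ (e - 1)) - 1 \<in> J"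
  using fil_power[OF _ assms, of "e - 1"] e fil_e[of _ "Suc 0"] by simp

text \<open>After the \<open>p ^ i\<close>-th power the exponent is outside the box, which makes the
  unit congruent to 1 modulo p and J; e - 1 further p-th powers make it trivial.\<close>

lemma gens_order:
  assumes "d \<in> gens p nu i" "i \<ge> 1"
  shows "(1 + mon y d) ^ (p ^ (i + e - 1)) - 1 \<in> J"
proof -
  have "d \<noteq> {#}" using assms by (auto simp: gens_def)
  then have d1: "Suc 0 \<le> size d" by (cases "size d") auto
  obtain a where a: "a \<in> aug y (Suc 0)" "(1 + mon y d) ^ (p ^ i) = 1 + mon y d ^ (p ^ i) + of_nat p * a"
    using frobenius_mod_p[OF p aug_mon[OF d1]] by blast
  have "mon y (repeat_mset (p ^ i) d) \<in> fil 1 (Suc 0)"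
    using assms by (intro mon_not_box) (auto simp: gens_def repeat_level)
  then have "mon y d ^ (p ^ i) + of_nat p ^ 1 * a \<in> fil 1 (Suc 0)"
    using a by (intro fil_add fil_aug) (auto simp: mon_repeat)
  then have "(1 + mon y d) ^ (p ^ i) - 1 \<in> fil 1 (Suc 0)"
    unfolding a(2) by simp
  then have "((1 + mon y d) ^ (p ^ i)) ^ (p ^ (e - 1)) - 1 \<in> J"
    by (rule fil_1_order)
  moreover have "i + e - 1 = i + (e - 1)" using e by simp
  ultimately show ?thesis by (simp add: power_add flip: power_mult)
qed

lemma aug_large: "\<exists>B. \<forall>N\<ge>B. aug y N \<subseteq> fil 1 (Suc 0)"
proof -
  \<comment> \<open>Larger than the size of every exponent in the box, so that all monomials of
    degree at least B leave it.\<close>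
  define B where "B = Suc (\<Sum>j\<in>{j. nu j \<noteq> 0}. p ^ nu j)"
  have big: "mon y d \<in> fil 1 (Suc 0)" if "B \<le> size d" for d
  proof (rule mon_not_box, rule notI)
    assume d: "d \<in> level p nu 0"
    have "set_mset d \<subseteq> {j. nu j \<noteq> 0}"
    proof
      fix j assume "j \<in># d"
      then have "0 < count d j" by (simp only: count_greater_zero_iff)
      moreover have "count d j < p ^ nu j" using d by (simp add: level_def)
      ultimately show "j \<in> {j. nu j \<noteq> 0}" by (cases "nu j = 0") (simp_all del: count_greater_zero_iff)
    qed
    have "size d = (\<Sum>j\<in>set_mset d. count d j)" by (simp add: size_multiset_overloaded_eq)
    also have "\<dots> \<le> (\<Sum>j\<in>set_mset d. p ^ nu j)"
      using d by (intro sum_mono) (auto simp: level_def less_imp_le)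
    also have "\<dots> \<le> (\<Sum>j\<in>{j. nu j \<noteq> 0}. p ^ nu j)"
      using \<open>set_mset d \<subseteq> _\<close> fin by (intro sum_mono2) auto
    finally show False using that by (simp add: B_def)
  qed
  have "a \<in> fil 1 (Suc 0)" if "N \<ge> B" "a \<in> aug y N" for a N
    using that(2)
  proof (induction rule: aug.induct)
    case (step a d c)
    have "mon y d * of_int c \<in> fil 1 (Suc 0)"
      using step that by (intro fil_mult_0 big) auto
    then show ?case using step by (auto intro: fil_add simp: mult.commute)
  qed (simp add: fil_J)
  then show ?thesis by blast
qed

text \<open>The augmentation ideal is nilpotent modulo p and J, so a high p-power of u is 1 up to
  multiples of p, where the order is already under control. This supplies the inverses in the group
  ring, which the polynomial ring does not contain.\<close>

lemma unit_order:
  assumes "u - 1 \<in> fil 0 (Suc 0)"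
  shows "\<exists>n>0. u ^ n - 1 \<in> J"
proof -
  obtain a b c where abc: "a \<in> aug y (Suc 0)" "b \<in> aug y (Suc 0)" "c \<in> J"
    "u - 1 = of_nat p ^ 0 * (a + of_nat p * b) + c" using assms(1) by (rule filE)
  define z where "z = a + of_nat p * b"
  have z: "z \<in> aug y (Suc 0)" unfolding z_def using abc(1,2) by (simp add: aug_add aug_mult_0)
  obtain B where B: "\<forall>N\<ge>B. aug y N \<subseteq> fil 1 (Suc 0)" using aug_large by blast
  obtain a' where a': "a' \<in> aug y (Suc 0)" "(1 + z) ^ (p ^ B) = 1 + z ^ (p ^ B) + of_nat p * a'"
    using frobenius_mod_p[OF p z] by blast
  have "B \<le> p ^ B" using p_gt_1 by (simp add: less_imp_le power_gt_expt)
  then have "z ^ (p ^ B) \<in> fil 1 (Suc 0)"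
    using B aug_power[OF z, of "p ^ B"] by auto
  then have 1: "(1 + z) ^ (p ^ B) - 1 \<in> fil 1 (Suc 0)"
    unfolding a'(2) using fil_add fil_aug[OF a'(1), of 1] by simp
  have "u ^ (p ^ B) - (1 + z) ^ (p ^ B) \<in> J"
    by (rule J_power) (use abc in \<open>simp add: z_def algebra_simps\<close>)
  from fil_add[OF 1 fil_J[OF this]] have "u ^ (p ^ B) - 1 \<in> fil 1 (Suc 0)" by simp
  from fil_1_order[OF this] have "u ^ (p ^ B * p ^ (e - 1)) - 1 \<in> J" by (simp add: power_mult)
  then show ?thesis using p_gt_1 by (intro exI[of _ "p ^ B * p ^ (e - 1)"]) auto
qed

lemma fil_mult_p_power: "x \<in> fil j N \<Longrightarrow> of_nat p ^ k * x \<in> fil (j + k) N"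
  by (induction k) (auto simp: mult.assoc dest: fil_mult_p)

text \<open>One more factor p outweighs any degree; the summand \<open>of_nat p * b\<close> in
  \<open>fil\<close> is there to make this true.\<close>

lemma fil_Suc: "x \<in> fil (Suc k) (Suc 0) \<Longrightarrow> x \<in> fil k N"
proof (elim filE)
  fix a b c assume "a \<in> aug y (Suc 0)" "b \<in> aug y (Suc 0)" "c \<in> J"
    "x = of_nat p ^ Suc k * (a + of_nat p * b) + c"
  then show "x \<in> fil k N"
    by (intro filI[of 0 _ "a + of_nat p * b" c])
      (simp_all add: aug.zero aug_add aug_mult_0 mult.assoc mult.left_commute[of _ "of_nat p ^ k"])
qed

text \<open>The cross term (u - 1)(v - 1) has degree at least 2 N > N, so multiplying units amounts
  to adding leading terms.\<close>

lemma lead_mult: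
  assumes "u - 1 - of_nat p ^ k * a \<in> fil k (Suc N)" "v - 1 - of_nat p ^ k * b \<in> fil k (Suc N)"
    and "a \<in> aug y N" "b \<in> aug y N" "N \<ge> 1"
  shows "u * v - 1 - of_nat p ^ k * (a + b) \<in> fil k (Suc N)"
proof -
  let ?P = "of_nat p :: 'r"
  have s: "u - 1 \<in> fil k N"
    using fil_add[OF fil_mono[OF assms(1)] fil_aug[OF assms(3), of k]] by simp
  have t: "v - 1 \<in> fil k N"
    using fil_add[OF fil_mono[OF assms(2)] fil_aug[OF assms(4), of k]] by simp
  have "(u - 1) * (v - 1) \<in> fil k (Suc N)"
    using fil_mono[OF fil_mult[OF s t]] assms(5) by simp
  then have "(u - 1 - ?P ^ k * a) + (v - 1 - ?P ^ k * b) + (u - 1) * (v - 1) \<in> fil k (Suc N)"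
    using assms by (intro fil_add)
  then show ?thesis by (simp add: algebra_simps)
qed

section \<open>Primitive parts of exponents\<close>

lemma primitive_part:
  assumes "d \<noteq> {#}"
  shows "\<exists>a d0. d = repeat_mset (p ^ a) d0 \<and> (\<exists>j. \<not> p dvd count d0 j)"
  using assms
proof (induction "size d" arbitrary: d rule: less_induct)
  case less
  show ?case
  proof (cases "\<exists>j. \<not> p dvd count d j")
    case True
    then show ?thesis by (intro exI[of _ 0] exI[of _ d]) simp
  next
    case False
    then obtain d' where d: "d = repeat_mset p d'"
      using repeat_div[of p d] p_gt_1 by auto
    have "d' \<noteq> {#}" using less.prems d by auto
    then have "size d' > 0" by (simp add: nonempty_has_size)
    then have "size d' < size d" using p_gt_1 d by simp
    then obtain a d0 where "d' = repeat_mset (p ^ a) d0" "\<exists>j. \<not> p dvd count d0 j"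
      using less.hyps \<open>d' \<noteq> {#}\<close> by blast
    then show ?thesis
      using d by (intro exI[of _ "Suc a"] exI[of _ d0]) simp
  qed
qed

lemma not_in_level:
  assumes "d \<noteq> {#}" shows "\<exists>k. d \<notin> level p nu k"
proof -
  obtain j where j: "j \<in># d" using assms by auto
  then have "count d j \<ge> 1" by (simp add: Suc_le_eq)
  then have "p ^ nu j * 1 \<le> p ^ nu j * count d j" by (intro mult_le_mono) auto
  then show ?thesis by (intro exI[of _ "nu j"]) (auto simp: level_def not_less intro!: exI[of _ j])
qed

lemma in_gens:
  assumes "d \<in> level p nu 0" "\<not> p dvd count d j" "size d \<noteq> 1"
  obtains i where "i \<ge> 1" "d \<in> gens p nu i"
proof -
  have "d \<noteq> {#}" using assms by auto
  then obtain k where k: "d \<notin> level p nu k" using not_in_level by blast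
  define i where "i = (LEAST k. d \<notin> level p nu k)"
  have i: "d \<notin> level p nu i" unfolding i_def by (rule LeastI[of _ k]) (fact k)
  have "i \<noteq> 0"
  proof
    assume "i = 0"
    with i assms show False by simp
  qed
  moreover from this have "d \<in> level p nu (i - 1)"
    using not_less_Least[of "i - 1" "\<lambda>k. d \<notin> level p nu k"] by (auto simp: i_def)
  ultimately show ?thesis using that[of i] i assms by (auto simp: gens_def)
qed

section \<open>Successive approximation by products of generators\<close>

context
  fixes H :: "'r set"
  assumes H_one: "1 \<in> H"
    and H_mult: "\<And>g h. g \<in> H \<Longrightarrow> h \<in> H \<Longrightarrow> g * h \<in> H"
    and H_y: "\<And>j. 1 + y j \<in> H"
    and H_gens: "\<And>i d. i \<ge> 1 \<Longrightarrow> d \<in> gens p nu i \<Longrightarrow> 1 + mon y d \<in> H"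
    and H_extras: "\<And>d. d \<in> extras p nu \<Longrightarrow> 1 + of_nat p * mon y d \<in> H"
begin

lemma H_power: "g \<in> H \<Longrightarrow> g ^ n \<in> H"
  by (induction n) (auto intro: H_one H_mult)

text \<open>For \<open>k = 0\<close> a p-power of the unit belonging to the primitive part of d
  works, since modulo p it just multiplies the exponent. For larger k, the factor p comes from the
  \<open>p ^ i\<close>-th power of a generator if d is one of the \<open>tops\<close>, and from an
  extra generator otherwise; further p-th powers raise it to p^k.\<close>

lemma lead_element:
  assumes d: "d \<in> level p nu 0" "d \<noteq> {#}"
  shows "\<exists>g\<in>H. g - 1 - of_nat p ^ k * mon y d \<in> fil k (Suc (size d))"
proof (cases k)
  case 0
  obtain a d0 j where d0: "d = repeat_mset (p ^ a) d0" "\<not> p dvd count d0 j"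
    using primitive_part[OF d(2)] by blast
  have "count d0 j' \<le> count d j'" for j'
    using d0 p_gt_1 by simp
  moreover have "count d j' < p ^ nu j'" for j'
    using d by (simp add: level_def)
  ultimately have l: "d0 \<in> level p nu 0"
    unfolding level_def using le_less_trans by simp blast
  have "d0 \<noteq> {#}" using d0 by auto
  then have s: "Suc 0 \<le> size d0" by (cases "size d0") auto
  have "1 + mon y d0 \<in> H"
  proof (cases "size d0 = 1")
    case True
    then obtain j where "d0 = {#j#}" using size_1_singleton_mset by blast
    then show ?thesis using H_y by simp
  next
    case False
    with in_gens[OF l d0(2)] obtain i where "i \<ge> 1" "d0 \<in> gens p nu i" by blast
    then show ?thesis by (rule H_gens)
  qed
  then have "(1 + mon y d0) ^ (p ^ a) \<in> H" by (rule H_power)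
  moreover obtain b where b: "b \<in> aug y (Suc 0)"
    "(1 + mon y d0) ^ (p ^ a) = 1 + mon y d0 ^ (p ^ a) + of_nat p * b"
    using frobenius_mod_p[OF p aug_mon[OF s]] by blast
  have "(1 + mon y d0) ^ (p ^ a) - 1 - of_nat p ^ k * mon y d \<in> fil k (Suc (size d))"
    by (rule filI[of 0 _ b 0]) (use b in \<open>auto simp: 0 d0 mon_repeat aug.zero\<close>)
  ultimately show ?thesis by blast
next
  case (Suc k')
  have s: "1 \<le> size d" using d by (cases "size d") auto
  have iter: "u ^ (p ^ k') - 1 - of_nat p ^ k * mon y d \<in> fil k (Suc (size d))"
    if "u - 1 - of_nat p ^ 1 * mon y d \<in> fil 1 (Suc (size d))" for u
    using lead_power_iter[OF _ s aug_mon[OF order_refl] that, of k'] Suc by simp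
  show ?thesis
  proof (cases "d \<in> tops p nu")
    case True
    then obtain i d0 where i: "i \<ge> 1" "d0 \<in> gens p nu i" "d = repeat_mset (p ^ (i - 1)) d0"
      by (auto simp: tops_def)
    have "((1 + mon y d0) ^ (p ^ i)) ^ (p ^ k') - 1 - of_nat p ^ k * mon y d \<in> fil k (Suc (size d))"
      using gens_lead[OF i(2,1)] i(3) by (intro iter) simp
    then show ?thesis using H_gens[OF i(1,2)] H_power by blast
  next
    case False
    then have "d \<in> extras p nu" using d by (auto simp: extras_def)
    moreover have "(1 + of_nat p * mon y d) ^ (p ^ k') - 1 - of_nat p ^ k * mon y d \<in> fil k (Suc (size d))"
      by (rule iter) (simp add: fil_J)
    ultimately show ?thesis using H_extras H_power by blast
  qed
qed

text \<open>The leading part is cancelled one monomial at a time, along the inductive generation of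
  \<open>aug\<close>. Monomials of higher degree are negligible at once, and so are those outside
  the box, because they bring another factor p.\<close>

lemma kill_lead:
  assumes "a \<in> aug y N" "N \<ge> 1" "u - 1 - of_nat p ^ k * a \<in> fil k (Suc N)"
  shows "\<exists>h\<in>H. u * h - 1 \<in> fil k (Suc N)"
  using assms
proof (induction arbitrary: u rule: aug.induct)
  case zero
  then show ?case by (intro bexI[of _ 1] H_one) simp
next
  case (step a d c)
  let ?P = "of_nat p :: 'r"
  have absorb: ?case if "?P ^ k * (of_int c * mon y d) \<in> fil k (Suc N)"
  proof (rule step.IH)
    show "u - 1 - ?P ^ k * a \<in> fil k (Suc N)"
      using fil_add[OF step.prems(2) that] by (simp add: algebra_simps)
  qed (fact step.prems)
  consider "size d > N" | "size d = N" "d \<notin> level p nu 0" | "size d = N" "d \<in> level p nu 0"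
    using step.hyps by linarith
  then show ?case
  proof cases
    case 1
    then show ?thesis by (intro absorb fil_aug aug_of_int_mon) auto
  next
    case 2
    have "mon y d \<in> fil 0 (Suc N)"
      by (rule fil_Suc) (use mon_not_box[OF 2(2)] in simp)
    from fil_mult_0[OF this aug_of_int, of c] have "of_int c * mon y d \<in> fil 0 (Suc N)"
      by (subst mult.commute)
    from fil_mult_p_power[OF this, of k] show ?thesis by (intro absorb) simp
  next
    case 3
    have "d \<noteq> {#}" using 3(1) step.prems(1) by (cases "d = {#}") simp_all
    from lead_element[OF 3(2) this, of k]
    obtain g where g: "g \<in> H" "g - 1 - ?P ^ k * mon y d \<in> fil k (Suc N)"
      unfolding 3(1) by blast
    have m: "mon y d \<in> aug y N" using 3 by (intro aug_mon) simp
    have gn: "g ^ n - 1 - ?P ^ k * (of_nat n * mon y d) \<in> fil k (Suc N)" for n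
    proof (induction n)
      case 0
      show ?case by (simp add: fil_J)
    next
      case (Suc n)
      have "g * g ^ n - 1 - ?P ^ k * (mon y d + of_nat n * mon y d) \<in> fil k (Suc N)"
        using g Suc m step.prems by (intro lead_mult aug_mult_0) simp_all
      then show ?case by (simp add: algebra_simps)
    qed
    \<comment> \<open>H is closed under products only, so the coefficient c has to be cancelled by a
      power with nonnegative exponent. Taking n congruent to - c modulo p^e is enough, as p^e lies
      in J.\<close>
    define n where "n = nat ((- c) mod int (p ^ e))"
    have "int n = (- c) mod int (p ^ e)" unfolding n_def using p_gt_1 by simp
    then have "int (p ^ e) dvd c + int n"
      unfolding dvd_eq_mod_eq_0 by (metis add.right_inverse mod_0 mod_add_right_eq)
    then obtain t where t: "c + int n = int (p ^ e) * t" by (rule dvdE)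
    have "of_int c + of_nat n = (of_int (c + int n) :: 'r)" by simp
    also have "\<dots> = ?P ^ e * of_int t" unfolding t by simp
    finally have "of_int c + of_nat n = (?P ^ e * of_int t :: 'r)" .
    then have "of_int c + of_nat n \<in> J" using J_mult' J_p by simp
    then have J: "?P ^ k * ((of_int c + of_nat n) * mon y d) \<in> J"
      by (intro J_mult J_mult')
    have "a + of_int c * mon y d \<in> aug y N" using step.hyps by (rule aug.step)
    then have "u * g ^ n - 1 - ?P ^ k * (a + of_int c * mon y d + of_nat n * mon y d) \<in> fil k (Suc N)"
      using step.prems gn m by (intro lead_mult aug_mult_0) simp_all
    from fil_add[OF this fil_J[OF J]] have "u * g ^ n - 1 - ?P ^ k * a \<in> fil k (Suc N)"
      by (simp add: algebra_simps)
    from step.IH[OF step.prems(1) this] obtain h where "h \<in> H" "u * g ^ n * h - 1 \<in> fil k (Suc N)"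
      by blast
    then show ?thesis
      using H_mult[OF H_power[OF g(1)]] by (intro bexI[of _ "g ^ n * h"]) (simp_all add: mult.assoc)
  qed
qed

lemma improve:
  assumes "u - 1 \<in> fil k N" "N \<ge> 1"
  shows "\<exists>h\<in>H. u * h - 1 \<in> fil k (Suc N)"
proof -
  obtain a b c where abc: "a \<in> aug y N" "b \<in> aug y (Suc 0)" "c \<in> J"
    "u - 1 = of_nat p ^ k * (a + of_nat p * b) + c" using assms(1) by (rule filE)
  have "u - 1 - of_nat p ^ k * a \<in> fil k (Suc N)"
    by (rule filI[of 0 _ b c]) (use abc in \<open>auto simp: aug.zero algebra_simps\<close>)
  from kill_lead[OF abc(1) assms(2) this] show ?thesis .
qed

lemma improve_iter:
  assumes "u - 1 \<in> fil k (Suc 0)"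
  shows "\<exists>h\<in>H. u * h - 1 \<in> fil k (Suc n)"
proof (induction n)
  case 0
  then show ?case using assms by (intro bexI[of _ 1] H_one) simp
next
  case (Suc n)
  then obtain h where h: "h \<in> H" "u * h - 1 \<in> fil k (Suc n)" by blast
  obtain h' where h': "h' \<in> H" "u * h * h' - 1 \<in> fil k (Suc (Suc n))"
    using improve[OF h(2)] by auto
  then show ?case using H_mult[OF h(1)] by (intro bexI[of _ "h * h'"]) (simp_all add: mult.assoc)
qed

text \<open>At a fixed power of p the degree can be raised beyond the bound from which on monomials
  yield a factor p; this is how the approximation passes to the next power of p.\<close>

lemma improve_p:
  assumes "u - 1 \<in> fil k (Suc 0)"
  shows "\<exists>h\<in>H. u * h - 1 \<in> fil (Suc k) (Suc 0)"
proof -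
  obtain B where B: "\<forall>N\<ge>B. aug y N \<subseteq> fil 1 (Suc 0)" using aug_large by blast
  obtain h where h: "h \<in> H" "u * h - 1 \<in> fil k (Suc B)"
    using improve_iter[OF assms] by blast
  obtain a b c where abc: "a \<in> aug y (Suc B)" "b \<in> aug y (Suc 0)" "c \<in> J"
    "u * h - 1 = of_nat p ^ k * (a + of_nat p * b) + c" using h(2) by (rule filE)
  have "a \<in> fil 1 (Suc 0)" using B abc(1) le_SucI[of B B] by blast
  then have "of_nat p ^ k * a \<in> fil (1 + k) (Suc 0)" by (rule fil_mult_p_power)
  then have "of_nat p ^ k * a + of_nat p ^ Suc k * b + c \<in> fil (Suc k) (Suc 0)"
    using fil_add[OF fil_add[OF _ fil_aug[OF abc(2), of "Suc k"]] fil_J[OF abc(3)]] by simp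
  then show ?thesis using h abc by (intro bexI[of _ h]) (simp_all add: algebra_simps)
qed

lemma units_generated:
  assumes "u - 1 \<in> fil 0 (Suc 0)"
  shows "\<exists>h\<in>H. u * h - 1 \<in> J"
proof -
  have "\<exists>h\<in>H. u * h - 1 \<in> fil k (Suc 0)" for k
  proof (induction k)
    case 0
    then show ?case using assms by (intro bexI[of _ 1] H_one) simp
  next
    case (Suc k)
    then obtain h where h: "h \<in> H" "u * h - 1 \<in> fil k (Suc 0)" by blast
    obtain h' where h': "h' \<in> H" "u * h * h' - 1 \<in> fil (Suc k) (Suc 0)"
      using improve_p[OF h(2)] by auto
    then show ?case using H_mult[OF h(1)] by (intro bexI[of _ "h * h'"]) (simp_all add: mult.assoc)
  qed
  \<comment> \<open>After e rounds the error is a multiple of p^e, hence in J.\<close>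
  from this[of e] show ?thesis using fil_e by blast
qed

end

end

section \<open>Direct complements in finite abelian groups\<close>

lemma (in group) int_pow_mod_order:
  assumes "x \<in> carrier G" "x [^] (m::nat) = \<one>"
  shows "x [^] (k mod int m) = x [^] (k::int)"
proof -
  have "x [^] k = x [^] (int m * (k div int m) + k mod int m)" by simp
  also have "\<dots> = (x [^] int m) [^] (k div int m) \<otimes> x [^] (k mod int m)"
    by (simp only: int_pow_mult[OF assms(1)] int_pow_pow[OF assms(1)])
  also have "x [^] int m = \<one>" using assms by (simp add: int_pow_int)
  finally show ?thesis using assms by simp
qed

lemma prod_list_nth: "prod_list ms = (\<Prod>i<length ms. ms ! i :: nat)"
  by (simp add: prod.list_conv_set_nth atLeast0LessThan)

text \<open>Multiplication maps A times the abstract product of cyclic groups onto V by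
  \<open>gen\<close>; both sides have the same finite order, so the map is injective too. Hence each
  m turns out to be the exact order of its b, although only b^m = 1 is assumed. Generation is
  expressed by closure under products because that is what the approximation provides.\<close>

lemma direct_complement:
  fixes V :: "('c, 'd) monoid_scheme" and bms :: "('c \<times> nat) list"
  assumes "comm_group V" and fin: "finite (carrier V)" and A: "subgroup A V"
    and bms: "\<And>b m. (b, m) \<in> set bms \<Longrightarrow> b \<in> carrier V \<and> m > 0 \<and> b [^]\<^bsub>V\<^esub> m = \<one>\<^bsub>V\<^esub>"
    and gen: "\<And>S. A \<subseteq> S \<Longrightarrow> fst ` set bms \<subseteq> S \<Longrightarrow> (\<And>x y. x \<in> S \<Longrightarrow> y \<in> S \<Longrightarrow> x \<otimes>\<^bsub>V\<^esub> y \<in> S)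
      \<Longrightarrow> carrier V \<subseteq> S"
    and card: "card A * prod_list (map snd bms) = card (carrier V)"
  shows "\<exists>L. internal_direct_product V A L \<and> V\<lparr>carrier := L\<rparr> \<cong> cyclic_product (map snd bms)"
proof -
  interpret V: comm_group V by fact
  define N where "N = length bms"
  define b where "b i = fst (bms ! i)" for i
  define m where "m i = map snd bms ! i" for i
  have bm: "b i \<in> carrier V" "m i > 0" "b i [^]\<^bsub>V\<^esub> m i = \<one>\<^bsub>V\<^esub>" if "i < N" for i
    using bms[of "b i" "m i"] nth_mem[of i bms] that by (auto simp: b_def m_def N_def)
  define P where "P = product_group {..<N} (\<lambda>i. integer_mod_group (m i))"
  have P_eq: "cyclic_product (map snd bms) = P"
    by (simp add: cyclic_product_def P_def m_def N_def)
  have P_group: "group P" unfolding P_def by (intro product_group) simp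
  have P_carrier: "carrier P = (\<Pi>\<^sub>E i\<in>{..<N}. {0..<int (m i)})"
    unfolding P_def carrier_product_group
    by (intro PiE_cong) (use bm(2) in \<open>auto simp: carrier_integer_mod_group\<close>)
  have P_fin: "finite (carrier P)" unfolding P_carrier by (intro finite_PiE) auto
  have P_card: "card (carrier P) = prod_list (map snd bms)"
    unfolding P_carrier by (simp add: card_PiE prod_list_nth m_def N_def)
  define f where "f c = finprod V (\<lambda>i. b i [^]\<^bsub>V\<^esub> (c i :: int)) {..<N}" for c
  have f_closed: "f c \<in> carrier V" for c
    unfolding f_def using bm by (intro V.finprod_closed) auto
  have f_mult: "f (x \<otimes>\<^bsub>P\<^esub> y) = f x \<otimes>\<^bsub>V\<^esub> f y" for x y
  proof -
    have "f (x \<otimes>\<^bsub>P\<^esub> y) = finprod V (\<lambda>i. b i [^]\<^bsub>V\<^esub> x i \<otimes>\<^bsub>V\<^esub> b i [^]\<^bsub>V\<^esub> y i) {..<N}"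
      unfolding f_def
    proof (rule V.finprod_cong')
      fix i assume "i \<in> {..<N}"
      then have "(x \<otimes>\<^bsub>P\<^esub> y) i = (x i + y i) mod int (m i)" by (simp add: P_def)
      then show "b i [^]\<^bsub>V\<^esub> (x \<otimes>\<^bsub>P\<^esub> y) i = b i [^]\<^bsub>V\<^esub> x i \<otimes>\<^bsub>V\<^esub> b i [^]\<^bsub>V\<^esub> y i"
        using bm[of i] \<open>i \<in> {..<N}\<close> by (simp add: V.int_pow_mod_order V.int_pow_mult)
    qed (use bm in auto)
    also have "\<dots> = f x \<otimes>\<^bsub>V\<^esub> f y"
      unfolding f_def using bm by (intro V.finprod_multf) auto
    finally show ?thesis .
  qed
  have f_hom: "f \<in> hom P V" by (auto simp: hom_def f_mult f_closed)
  interpret f: group_hom P V f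
    using P_group f_hom V.group_axioms by (simp add: group_hom_def group_hom_axioms_def)
  define L where "L = f ` carrier P"
  have L: "subgroup L V" unfolding L_def by (rule f.img_is_subgroup)
  have b_in: "b i \<in> L" if i: "i < N" for i
  proof -
    \<comment> \<open>The residue is written \<open>1 mod int (m i)\<close> because for
      \<open>m i = 1\<close> the representative is 0. This case occurs: the extra generators have m
      = 1 when e = 1.\<close>
    define c where "c = (\<lambda>j\<in>{..<N}. if j = i then 1 mod int (m i) else 0)"
    have c: "c \<in> carrier P" unfolding P_carrier c_def using bm(2) i by auto
    have "f c = finprod V (\<lambda>j. if i = j then b j else \<one>\<^bsub>V\<^esub>) {..<N}"
      unfolding f_def
    proof (rule V.finprod_cong')
      fix j assume "j \<in> {..<N}"
      then show "b j [^]\<^bsub>V\<^esub> c j = (if i = j then b j else \<one>\<^bsub>V\<^esub>)"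
        using bm by (auto simp: c_def V.int_pow_mod_order simp del: mod_self)
    qed (use bm in auto)
    also have "\<dots> = b i"
      using i bm by (intro V.finprod_singleton) auto
    finally show ?thesis using c unfolding L_def by force
  qed
  have AL: "A <#>\<^bsub>V\<^esub> L = carrier V"
  proof
    show "A <#>\<^bsub>V\<^esub> L \<subseteq> carrier V"
      using A L by (meson V.set_mult_closed subgroup.subset)
    show "carrier V \<subseteq> A <#>\<^bsub>V\<^esub> L"
    proof (rule gen)
      show "A \<subseteq> A <#>\<^bsub>V\<^esub> L"
      proof
        fix a assume "a \<in> A"
        then have "a = a \<otimes>\<^bsub>V\<^esub> \<one>\<^bsub>V\<^esub>" using A by (simp add: subgroup.mem_carrier)
        then show "a \<in> A <#>\<^bsub>V\<^esub> L"
          using \<open>a \<in> A\<close> subgroup.one_closed[OF L] unfolding set_mult_def by blast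
      qed
      show "fst ` set bms \<subseteq> A <#>\<^bsub>V\<^esub> L"
      proof
        fix x assume "x \<in> fst ` set bms"
        then obtain i where i: "i < N" "x = b i"
          by (auto simp: b_def N_def set_conv_nth)
        then have "x = \<one>\<^bsub>V\<^esub> \<otimes>\<^bsub>V\<^esub> x" using bm by simp
        then show "x \<in> A <#>\<^bsub>V\<^esub> L"
          using b_in i subgroup.one_closed[OF A] unfolding set_mult_def by blast
      qed
      fix x y assume "x \<in> A <#>\<^bsub>V\<^esub> L" "y \<in> A <#>\<^bsub>V\<^esub> L"
      then obtain a l a' l' where *: "a \<in> A" "l \<in> L" "a' \<in> A" "l' \<in> L" "x = a \<otimes>\<^bsub>V\<^esub> l" "y = a' \<otimes>\<^bsub>V\<^esub> l'"
        unfolding set_mult_def by blast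
      then have "a \<in> carrier V" "l \<in> carrier V" "a' \<in> carrier V" "l' \<in> carrier V"
        using A L by (auto simp: subgroup.mem_carrier)
      then have "x \<otimes>\<^bsub>V\<^esub> y = (a \<otimes>\<^bsub>V\<^esub> a') \<otimes>\<^bsub>V\<^esub> (l \<otimes>\<^bsub>V\<^esub> l')"
        using * by (simp add: V.m_ac)
      then show "x \<otimes>\<^bsub>V\<^esub> y \<in> A <#>\<^bsub>V\<^esub> L"
        using * A L unfolding set_mult_def by (blast intro: subgroup.m_closed)
    qed
  qed
  define g where "g = (\<lambda>(a, c). a \<otimes>\<^bsub>V\<^esub> f c)"
  have "g ` (A \<times> carrier P) = carrier V"
    unfolding AL[symmetric] by (auto simp: g_def L_def set_mult_def image_iff)
  moreover have "finite A" using A fin by (meson finite_subset subgroup.subset)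
  ultimately have inj: "inj_on g (A \<times> carrier P)"
    using P_fin card by (intro eq_card_imp_inj_on) (auto simp: card_cartesian_product P_card)
  have P_one: "\<one>\<^bsub>P\<^esub> \<in> carrier P" using P_group by (simp add: group.is_monoid monoid.one_closed)
  have Acar: "a \<in> carrier V" if "a \<in> A" for a using A that by (rule subgroup.mem_carrier)
  have inter: "A \<inter> L = {\<one>\<^bsub>V\<^esub>}"
  proof
    show "A \<inter> L \<subseteq> {\<one>\<^bsub>V\<^esub>}"
    proof
      fix x assume "x \<in> A \<inter> L"
      then obtain c where c: "x \<in> A" "c \<in> carrier P" "x = f c" by (auto simp: L_def)
      have "g (x, \<one>\<^bsub>P\<^esub>) = g (\<one>\<^bsub>V\<^esub>, c)"
        using c Acar by (simp add: g_def f_closed)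
      then have "(x, \<one>\<^bsub>P\<^esub>) = (\<one>\<^bsub>V\<^esub>, c)"
        using inj c P_one subgroup.one_closed[OF A] by (auto simp: inj_on_def)
      then show "x \<in> {\<one>\<^bsub>V\<^esub>}" by simp
    qed
  qed (use A L in \<open>auto simp: subgroup.one_closed\<close>)
  have "inj_on f (carrier P)"
  proof
    fix c c' assume c: "c \<in> carrier P" "c' \<in> carrier P" "f c = f c'"
    then have "g (\<one>\<^bsub>V\<^esub>, c) = g (\<one>\<^bsub>V\<^esub>, c')" by (simp add: g_def)
    then show "c = c'" using inj c subgroup.one_closed[OF A] by (auto simp: inj_on_def)
  qed
  then have "f \<in> iso P (V\<lparr>carrier := L\<rparr>)"
    using f_mult by (auto simp: iso_def hom_def bij_betw_def L_def)
  then have "V\<lparr>carrier := L\<rparr> \<cong> P"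
    using group.iso_sym[OF P_group] is_isoI by blast
  moreover have "internal_direct_product V A L"
    using A L inter AL by (simp add: internal_direct_product_def)
  ultimately show ?thesis unfolding P_eq by blast
qed

section \<open>The group ring as a quotient of a polynomial ring\<close>

lemma poly_mapping_single_induct [case_names single add]:
  fixes P :: "('m \<Rightarrow>\<^sub>0 int) \<Rightarrow> bool"
  assumes single: "\<And>M c. P (Poly_Mapping.single M c)"
    and add: "\<And>a b. P a \<Longrightarrow> P b \<Longrightarrow> P (a + b)"
  shows "P a"
proof -
  have "P (\<Sum>M\<in>S. Poly_Mapping.single M (Poly_Mapping.lookup a M))" if "finite S" for S
    using that
  proof induction
    case empty
    show ?case using single[of undefined 0] by simp
  qed (auto intro: single add)
  moreover have "(\<Sum>M\<in>Poly_Mapping.keys a. Poly_Mapping.single M (Poly_Mapping.lookup a M)) = a"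
    by (rule poly_mapping_eqI) (auto simp: lookup_sum lookup_single when_def in_keys_iff sum.delta)
  ultimately show ?thesis by (metis finite_keys)
qed

lemma single_mult_of_int: "Poly_Mapping.single M (c::int) = of_int c * Poly_Mapping.single (M::'m::comm_monoid_add) 1"
  using mult_single[of 0 c M "1::int"] by (metis add_0 mult.right_neutral of_int_eq_id id_apply single_of_int)

text \<open>A surjective monoid homomorphism \<open>ev\<close> extends linearly to a ring
  homomorphism from the integral monoid ring onto the group ring. Finitely supported functions form
  a type of class \<open>comm_ring_1\<close>, so ring identities can be proved there and carried
  over to the functions in \<open>gr_elems\<close>.\<close>

locale group_ring_hom = comm_group G for G (structure) +
  fixes ev :: "'m::comm_monoid_add \<Rightarrow> 'a" and m :: nat
  assumes fin: "finite (carrier G)"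
    and ev_range: "range ev = carrier G"
    and ev_0: "ev 0 = \<one>"
    and ev_add: "ev (M + N) = ev M \<otimes> ev N"
    and m: "m > 1"
begin

lemma ev_closed [simp]: "ev M \<in> carrier G"
  using ev_range by auto

text \<open>The coefficient of x in the image of P in the integral group ring, before reduction
  modulo m.\<close>

definition coeff_at :: "('m \<Rightarrow>\<^sub>0 int) \<Rightarrow> 'a \<Rightarrow> int" where
  "coeff_at P x = (\<Sum>M\<in>Poly_Mapping.keys P. if ev M = x then Poly_Mapping.lookup P M else 0)"

lemma coeff_at_superset:
  assumes "finite S" "Poly_Mapping.keys P \<subseteq> S"
  shows "coeff_at P x = (\<Sum>M\<in>S. if ev M = x then Poly_Mapping.lookup P M else 0)"
  unfolding coeff_at_def by (rule sum.mono_neutral_left) (use assms in \<open>auto simp: in_keys_iff\<close>)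

lemma coeff_at_add: "coeff_at (P + Q) x = coeff_at P x + coeff_at Q x"
proof -
  let ?S = "Poly_Mapping.keys P \<union> Poly_Mapping.keys Q"
  have "coeff_at (P + Q) x = (\<Sum>M\<in>?S. if ev M = x then Poly_Mapping.lookup (P + Q) M else 0)"
    using Poly_Mapping.keys_add[of P Q] by (intro coeff_at_superset) auto
  also have "\<dots> = (\<Sum>M\<in>?S. if ev M = x then Poly_Mapping.lookup P M else 0)
      + (\<Sum>M\<in>?S. if ev M = x then Poly_Mapping.lookup Q M else 0)"
    unfolding sum.distrib[symmetric] by (intro sum.cong) (auto simp: lookup_add)
  finally show ?thesis by (simp add: coeff_at_superset[of ?S])
qed

lemma coeff_at_single: "coeff_at (Poly_Mapping.single M c) x = (if ev M = x then c else 0)"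
  by (auto simp: coeff_at_def)

lemma coeff_at_zero [simp]: "coeff_at 0 x = 0"
  by (simp add: coeff_at_def)

lemma coeff_at_uminus: "coeff_at (- P) x = - coeff_at P x"
  using coeff_at_add[of P "- P" x] by simp

lemma coeff_at_diff: "coeff_at (P - Q) x = coeff_at P x - coeff_at Q x"
  using coeff_at_add[of P "- Q" x] by (simp add: coeff_at_uminus)

text \<open>Both sides are additive in each of P and Q, which leaves single monomials, where the
  claim is multiplicativity of \<open>ev\<close>.\<close>

lemma coeff_at_mult: 
  assumes x: "x \<in> carrier G"
  shows "coeff_at (P * Q) x = (\<Sum>y\<in>carrier G. coeff_at P y * coeff_at Q (inv y \<otimes> x))"
proof (induction P rule: poly_mapping_single_induct)
  case (single M c)
  have eq: "(ev M \<otimes> ev N = x) = (ev N = inv (ev M) \<otimes> x)" for N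
    using x by (metis ev_closed inv_solve_left)
  show ?case
  proof (induction Q rule: poly_mapping_single_induct)
    case (single N d)
    have "(\<Sum>y\<in>carrier G. coeff_at (Poly_Mapping.single M c) y * coeff_at (Poly_Mapping.single N d) (inv y \<otimes> x))
      = (\<Sum>y\<in>carrier G. if y = ev M then c * (if ev N = inv y \<otimes> x then d else 0) else 0)"
      by (intro sum.cong) (auto simp: coeff_at_single)
    also have "\<dots> = c * (if ev N = inv (ev M) \<otimes> x then d else 0)"
      using fin by (subst sum.delta) auto
    finally show ?case by (simp add: mult_single coeff_at_single ev_add eq)
  next
    case (add a b)
    then show ?case by (simp add: coeff_at_add ring_distribs sum.distrib)
  qed
next
  case (add a b)
  then show ?case by (simp add: coeff_at_add ring_distribs sum.distrib)
qed

section \<open>Augmentation and kernel\<close>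

definition total :: "('m \<Rightarrow>\<^sub>0 int) \<Rightarrow> int" where
  "total P = (\<Sum>x\<in>carrier G. coeff_at P x)"

lemma total_single [simp]: "total (Poly_Mapping.single M c) = c"
  using fin by (simp add: total_def coeff_at_single sum.delta')

lemma total_add [simp]: "total (P + Q) = total P + total Q"
  by (simp add: total_def coeff_at_add sum.distrib)

lemma total_diff [simp]: "total (P - Q) = total P - total Q"
  by (simp add: total_def coeff_at_diff sum_subtractf)

lemma total_one [simp]: "total 1 = 1"
  using total_single[of 0 1] by simp

lemma total_mult [simp]: "total (P * Q) = total P * total Q"
proof (induction P rule: poly_mapping_single_induct)
  case (single M c)
  show ?case
    by (induction Q rule: poly_mapping_single_induct) (simp_all add: mult_single ring_distribs)
qed (simp add: ring_distribs)

lemma total_power [simp]: "total (P ^ k) = total P ^ k"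
  by (induction k) simp_all

definition kernel :: "('m \<Rightarrow>\<^sub>0 int) set" where
  "kernel = {P. \<forall>x\<in>carrier G. int m dvd coeff_at P x}"

lemma kernel_add: "P \<in> kernel \<Longrightarrow> Q \<in> kernel \<Longrightarrow> P + Q \<in> kernel"
  by (simp add: kernel_def coeff_at_add)

lemma kernel_mult: "P \<in> kernel \<Longrightarrow> R * P \<in> kernel"
  by (auto simp: kernel_def coeff_at_mult intro!: dvd_sum dvd_mult)

lemma kernel_modulus: "of_nat m \<in> kernel"
  unfolding kernel_def
proof safe
  fix x
  have "coeff_at (of_nat m) x = (if ev 0 = x then int m else 0)"
    by (metis coeff_at_single single_of_nat)
  then show "int m dvd coeff_at (of_nat m) x" by simp
qed

lemma kernel_single: "ev M = ev N \<Longrightarrow> Poly_Mapping.single M c - Poly_Mapping.single N c \<in> kernel"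
  by (simp add: kernel_def coeff_at_diff coeff_at_single)

section \<open>The projection onto the group ring\<close>

definition proj :: "('m \<Rightarrow>\<^sub>0 int) \<Rightarrow> 'a \<Rightarrow> int" where
  "proj P = (\<lambda>x. if x \<in> carrier G then coeff_at P x mod int m else 0)"

lemma proj_eq_iff: "proj P = proj Q \<longleftrightarrow> P - Q \<in> kernel"
proof -
  have "proj P = proj Q \<longleftrightarrow> (\<forall>x\<in>carrier G. coeff_at P x mod int m = coeff_at Q x mod int m)"
    by (auto simp: proj_def fun_eq_iff)
  then show ?thesis by (simp add: kernel_def coeff_at_diff mod_eq_dvd_iff)
qed

lemma proj_elem: "proj P \<in> gr_elems G m"
  using m by (auto simp: gr_elems_def proj_def)

lemma proj_mult: "gr_mult G m (proj P) (proj Q) = proj (P * Q)"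
proof
  fix x
  show "gr_mult G m (proj P) (proj Q) x = proj (P * Q) x"
  proof (cases "x \<in> carrier G")
    case True
    have "(\<Sum>y\<in>carrier G. (coeff_at P y mod int m) * (coeff_at Q (inv y \<otimes> x) mod int m)) mod int m
      = (\<Sum>y\<in>carrier G. coeff_at P y * coeff_at Q (inv y \<otimes> x)) mod int m"
      by (subst (1 2) mod_sum_eq[symmetric]) (simp add: mod_mult_eq)
    moreover have "(\<Sum>y\<in>carrier G. proj P y * proj Q (inv y \<otimes> x))
      = (\<Sum>y\<in>carrier G. (coeff_at P y mod int m) * (coeff_at Q (inv y \<otimes> x) mod int m))"
      using True by (intro sum.cong) (auto simp: proj_def)
    ultimately show ?thesis
      using True by (simp add: gr_mult_def proj_def coeff_at_mult)
  next
    case False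
    then show ?thesis by (simp add: gr_mult_def proj_def)
  qed
qed

lemma proj_single: "proj (Poly_Mapping.single M 1) = gr_basis G m (ev M)"
  by (auto simp: proj_def gr_basis_def coeff_at_single fun_eq_iff)

lemma proj_one: "proj 1 = gr_one G m"
  using proj_single[of 0] by (simp add: gr_one_def ev_0)

lemma proj_augmentation: "gr_augmentation G m (proj P) = total P mod int m"
proof -
  have "(\<Sum>x\<in>carrier G. proj P x) = (\<Sum>x\<in>carrier G. coeff_at P x mod int m)"
    by (intro sum.cong) (auto simp: proj_def)
  then show ?thesis by (simp add: gr_augmentation_def total_def mod_sum_eq)
qed

definition sec :: "'a \<Rightarrow> 'm" where
  "sec x = (SOME M. ev M = x)"

lemma ev_sec: "x \<in> carrier G \<Longrightarrow> ev (sec x) = x"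
  unfolding sec_def using ev_range by (metis (mono_tags) imageE someI)

lemma coeff_at_sum: "coeff_at (sum h S) x = (\<Sum>i\<in>S. coeff_at (h i) x)"
  by (induction S rule: infinite_finite_induct) (auto simp: coeff_at_add)

lemma proj_section:
  assumes "f \<in> gr_elems G m"
  shows "proj (\<Sum>x\<in>carrier G. Poly_Mapping.single (sec x) (f x)) = f"
proof
  fix x
  show "proj (\<Sum>x\<in>carrier G. Poly_Mapping.single (sec x) (f x)) x = f x"
  proof (cases "x \<in> carrier G")
    case True
    have "coeff_at (\<Sum>x\<in>carrier G. Poly_Mapping.single (sec x) (f x)) x
      = (\<Sum>z\<in>carrier G. if z = x then f z else 0)"
      unfolding coeff_at_sum by (intro sum.cong) (auto simp: coeff_at_single ev_sec)
    also have "\<dots> = f x" using True fin by simp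
    finally show ?thesis using True assms by (simp add: proj_def gr_elems_def)
  next
    case False
    then show ?thesis using assms by (simp add: proj_def gr_elems_def)
  qed
qed

text \<open>The coefficients away from the identity are arbitrary, and the augmentation determines
  the one at the identity; \<open>ex\<close> restores it.\<close>

lemma card_augmentation_one:
  "card {f \<in> gr_elems G m. gr_augmentation G m f = 1 mod int m} = m ^ (card (carrier G) - 1)"
proof -
  let ?C = "carrier G - {\<one>}"
  let ?T = "\<Pi>\<^sub>E x\<in>?C. {0..<int m}"
  have one: "\<one> \<in> carrier G" by simp
  define ex where "ex h = (\<lambda>x. if x \<in> ?C then h x else if x = \<one> then (1 - (\<Sum>z\<in>?C. h z)) mod int m else 0)"
    for h :: "'a \<Rightarrow> int"
  have sum_split: "(\<Sum>x\<in>carrier G. f x) = f \<one> + (\<Sum>x\<in>?C. f x)" for f :: "'a \<Rightarrow> int"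
    using fin by (intro sum.remove) auto
  have "bij_betw (\<lambda>f. restrict f ?C) {f \<in> gr_elems G m. gr_augmentation G m f = 1 mod int m} ?T"
  proof (rule bij_betw_byWitness[where f' = ex])
    show "\<forall>f\<in>{f \<in> gr_elems G m. gr_augmentation G m f = 1 mod int m}. ex (restrict f ?C) = f"
    proof clarify
      fix f assume f: "f \<in> gr_elems G m" "gr_augmentation G m f = 1 mod int m"
      have "(f \<one> + (\<Sum>x\<in>?C. f x)) mod int m = 1 mod int m"
        using f(2) by (simp add: gr_augmentation_def sum_split)
      then have "(f \<one> + (\<Sum>x\<in>?C. f x) - (\<Sum>x\<in>?C. f x)) mod int m = (1 - (\<Sum>x\<in>?C. f x)) mod int m"
        by (rule mod_diff_cong) simp
      moreover have "f \<one> mod int m = f \<one>" using f(1) by (simp add: gr_elems_def)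
      ultimately have "(1 - (\<Sum>x\<in>?C. f x)) mod int m = f \<one>" by simp
      then show "ex (restrict f ?C) = f"
        using f(1) by (auto simp: ex_def fun_eq_iff gr_elems_def)
    qed
    show "\<forall>h\<in>?T. restrict (ex h) ?C = h"
    proof
      fix h assume "h \<in> ?T"
      then have "h \<in> extensional ?C" by (simp add: PiE_def)
      then show "restrict (ex h) ?C = h"
        by (intro extensionalityI[where A = ?C]) (simp_all add: ex_def)
    qed
    show "(\<lambda>f. restrict f ?C) ` {f \<in> gr_elems G m. gr_augmentation G m f = 1 mod int m} \<subseteq> ?T"
      unfolding image_subset_iff restrict_PiE_iff by (simp add: gr_elems_def)
    show "ex ` ?T \<subseteq> {f \<in> gr_elems G m. gr_augmentation G m f = 1 mod int m}"
    proof clarify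
      fix h assume h: "h \<in> ?T"
      have "ex h \<in> gr_elems G m"
        unfolding gr_elems_def
      proof (intro CollectI conjI allI impI)
        fix x
        show "ex h x \<in> {0..<int m}"
          using PiE_mem[OF h, of x] m unfolding ex_def by (simp only: split: if_split) simp
      qed (use one in \<open>simp add: ex_def, blast\<close>)
      moreover have "(\<Sum>x\<in>?C. ex h x) = (\<Sum>x\<in>?C. h x)"
        by (intro sum.cong) (auto simp: ex_def)
      then have "gr_augmentation G m (ex h) = 1 mod int m"
        unfolding gr_augmentation_def sum_split by (simp add: ex_def mod_add_left_eq)
      ultimately show "ex h \<in> gr_elems G m \<and> gr_augmentation G m (ex h) = 1 mod int m" by simp
    qed
  qed
  then have "card {f \<in> gr_elems G m. gr_augmentation G m f = 1 mod int m} = card ?T"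
    by (rule bij_betw_same_card)
  also have "\<dots> = m ^ (card (carrier G) - 1)"
    using fin one by (simp add: card_PiE card_Diff_singleton)
  finally show ?thesis .
qed

section \<open>The group of normalized units\<close>

lemma normalized_units_mult: "proj u \<otimes>\<^bsub>normalized_units G m\<^esub> proj v = proj (u * v)"
  by (simp add: normalized_units_def proj_mult)

lemma normalized_units_one: "\<one>\<^bsub>normalized_units G m\<^esub> = proj 1"
  by (simp add: normalized_units_def proj_one)

context
  assumes torsion: "\<forall>u. total u mod int m = 1 mod int m \<longrightarrow> (\<exists>n>0. u ^ n - 1 \<in> kernel)"
begin

text \<open>If u^n = 1 with n > 0, then u^(n-1) is an inverse of u; so under \<open>torsion\<close>
  augmentation 1 alone makes a unit.\<close>

lemma normalized_units_carrier:
  "carrier (normalized_units G m) = {f \<in> gr_elems G m. gr_augmentation G m f = 1 mod int m}"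
proof -
  have "f \<in> gr_units G m" if f: "f \<in> gr_elems G m" "gr_augmentation G m f = 1 mod int m" for f
  proof -
    obtain u where u: "proj u = f" using proj_section[OF f(1)] by blast
    then obtain n where n: "n > 0" "u ^ n - 1 \<in> kernel"
      using torsion[rule_format, of u] f(2) proj_augmentation[of u] by auto
    then have "proj (u ^ n) = gr_one G m" by (simp add: proj_eq_iff flip: proj_one)
    moreover have "u ^ n = u * u ^ (n - 1)" using n by (metis power_eq_if less_not_refl)
    ultimately have "gr_mult G m f (proj (u ^ (n - 1))) = gr_one G m"
      "gr_mult G m (proj (u ^ (n - 1))) f = gr_one G m"
      by (simp_all add: u[symmetric] proj_mult mult.commute)
    then show ?thesis using f(1) proj_elem unfolding gr_units_def by blast
  qed
  then show ?thesis by (auto simp: normalized_units_def gr_units_def)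
qed

lemma normalized_units_proj:
  "carrier (normalized_units G m) = {proj u | u. total u mod int m = 1 mod int m}"
  unfolding normalized_units_carrier
proof safe
  fix f assume f: "f \<in> gr_elems G m" "gr_augmentation G m f = 1 mod int m"
  obtain u where u: "f = proj u" using proj_section[OF f(1)] by metis
  then show "\<exists>u. f = proj u \<and> total u mod int m = 1 mod int m"
    using f(2) proj_augmentation by auto
qed (simp_all add: proj_augmentation proj_elem)

lemma proj_in_normalized_units:
  "total u mod int m = 1 mod int m \<Longrightarrow> proj u \<in> carrier (normalized_units G m)"
  unfolding normalized_units_proj by (intro CollectI exI[of _ u] conjI refl)

lemma normalized_unitsE:
  assumes "x \<in> carrier (normalized_units G m)"
  obtains u where "x = proj u" "total u mod int m = 1 mod int m"
proof -
  have "x \<in> {proj u | u. total u mod int m = 1 mod int m}"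
    using assms by (simp only: normalized_units_proj)
  then show ?thesis using that by blast
qed

lemma normalized_units_closed:
  assumes "x \<in> carrier (normalized_units G m)" "y \<in> carrier (normalized_units G m)"
  shows "x \<otimes>\<^bsub>normalized_units G m\<^esub> y \<in> carrier (normalized_units G m)"
proof -
  obtain u where u: "x = proj u" "total u mod int m = 1 mod int m"
    using assms(1) by (rule normalized_unitsE)
  obtain v where v: "y = proj v" "total v mod int m = 1 mod int m"
    using assms(2) by (rule normalized_unitsE)
  have "total (u * v) mod int m = 1 mod int m"
    using mod_mult_cong[OF u(2) v(2)] by simp
  then show ?thesis
    unfolding u(1) v(1) normalized_units_mult by (rule proj_in_normalized_units)
qed

lemma normalized_units_inverse:
  assumes "x \<in> carrier (normalized_units G m)"
  shows "\<exists>y\<in>carrier (normalized_units G m). y \<otimes>\<^bsub>normalized_units G m\<^esub> x = \<one>\<^bsub>normalized_units G m\<^esub>"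
proof -
  obtain u where u: "x = proj u" "total u mod int m = 1 mod int m"
    using assms by (rule normalized_unitsE)
  obtain n where n: "n > 0" "u ^ n - 1 \<in> kernel"
    using torsion u(2) by blast
  have un: "u ^ (n - 1) * u = u ^ n" using n by (intro power_minus_mult)
  then have "proj (u ^ (n - 1)) \<otimes>\<^bsub>normalized_units G m\<^esub> x = \<one>\<^bsub>normalized_units G m\<^esub>"
    unfolding u(1) normalized_units_mult normalized_units_one proj_eq_iff un using n(2) by simp
  moreover have "total (u ^ (n - 1)) mod int m = 1 mod int m"
    by (metis total_power power_mod power_one u(2))
  ultimately show ?thesis using proj_in_normalized_units by blast
qed

lemma normalized_units_comm_group: "comm_group (normalized_units G m)"
proof (rule comm_groupI)
  fix x y z
  assume "x \<in> carrier (normalized_units G m)" "y \<in> carrier (normalized_units G m)"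
    "z \<in> carrier (normalized_units G m)"
  then obtain u v w where "x = proj u" "y = proj v" "z = proj w" by (meson normalized_unitsE)
  then show "x \<otimes>\<^bsub>normalized_units G m\<^esub> y \<otimes>\<^bsub>normalized_units G m\<^esub> z
      = x \<otimes>\<^bsub>normalized_units G m\<^esub> (y \<otimes>\<^bsub>normalized_units G m\<^esub> z)"
    by (simp only: normalized_units_mult mult.assoc)
next
  fix x y
  assume "x \<in> carrier (normalized_units G m)" "y \<in> carrier (normalized_units G m)"
  then obtain u v where "x = proj u" "y = proj v" by (meson normalized_unitsE)
  then show "x \<otimes>\<^bsub>normalized_units G m\<^esub> y = y \<otimes>\<^bsub>normalized_units G m\<^esub> x"
    by (simp only: normalized_units_mult mult.commute)
next
  fix x
  assume "x \<in> carrier (normalized_units G m)"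
  then obtain u where "x = proj u" by (rule normalized_unitsE)
  then show "\<one>\<^bsub>normalized_units G m\<^esub> \<otimes>\<^bsub>normalized_units G m\<^esub> x = x"
    by (simp only: normalized_units_mult normalized_units_one mult_1)
next
  show "\<one>\<^bsub>normalized_units G m\<^esub> \<in> carrier (normalized_units G m)"
    unfolding normalized_units_one by (rule proj_in_normalized_units) simp
qed (fact normalized_units_closed normalized_units_inverse)+

lemma normalized_units_pow: "proj u [^]\<^bsub>normalized_units G m\<^esub> (k::nat) = proj (u ^ k)"
proof (induction k)
  interpret V: comm_group "normalized_units G m" by (rule normalized_units_comm_group)
  case 0
  show ?case by (simp only: V.nat_pow_0 normalized_units_one power_0)
next
  interpret V: comm_group "normalized_units G m" by (rule normalized_units_comm_group)
  case (Suc k)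
  have "proj u [^]\<^bsub>normalized_units G m\<^esub> Suc k
      = proj u [^]\<^bsub>normalized_units G m\<^esub> k \<otimes>\<^bsub>normalized_units G m\<^esub> proj u"
    by (rule V.nat_pow_Suc)
  also have "\<dots> = proj (u ^ Suc k)"
    unfolding Suc normalized_units_mult power_Suc2 ..
  finally show ?case .
qed

end

lemma gr_basis_inj: "inj_on (gr_basis G m) (carrier G)"
proof
  fix g h assume "gr_basis G m g = gr_basis G m h"
  then have "gr_basis G m g g = gr_basis G m h g" by simp
  then show "g = h" using m by (auto simp: gr_basis_def split: if_splits)
qed

end

section \<open>Counting exponents\<close>

definition prims :: "nat \<Rightarrow> (nat \<Rightarrow> nat) \<Rightarrow> nat \<Rightarrow> nat multiset set" where
  "prims p nu k = {d \<in> level p nu k. \<exists>j. \<not> p dvd count d j}"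

lemma level_antimono:
  assumes "p > 1" "k \<le> l" shows "level p nu l \<subseteq> level p nu k"
proof
  fix d assume d: "d \<in> level p nu l"
  have "p ^ k \<le> p ^ l" using assms by (intro power_increasing) auto
  then have "p ^ k * count d j \<le> p ^ l * count d j" for j by (rule mult_le_mono1)
  then show "d \<in> level p nu k"
    using d le_less_trans unfolding level_def by blast
qed

context
  fixes p :: nat and nu :: "nat \<Rightarrow> nat" and n :: nat
  assumes p: "p > 1" and fin0: "finite (level p nu 0)" and top: "level p nu n = {{#}}"
begin

lemma level_finite: "finite (level p nu k)"
  using level_antimono[OF p, of 0 k nu] fin0 by (auto intro: finite_subset)

lemma repeat_p_level: "repeat_mset p d \<in> level p nu k \<longleftrightarrow> d \<in> level p nu (Suc k)"
  by (simp add: level_def mult.assoc mult.left_commute)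

text \<open>Division by p matches the exponents of level k whose entries are all multiples of p with
  level k + 1.\<close>

lemma card_prims: "card (prims p nu k) + card (level p nu (Suc k)) = card (level p nu k)"
proof -
  have "level p nu k = prims p nu k \<union> repeat_mset p ` level p nu (Suc k)"
  proof (intro equalityI subsetI)
    fix d assume d: "d \<in> level p nu k"
    show "d \<in> prims p nu k \<union> repeat_mset p ` level p nu (Suc k)"
    proof (cases "\<exists>j. \<not> p dvd count d j")
      case False
      then obtain d' where "d = repeat_mset p d'" using repeat_div[of p d] p by auto
      then show ?thesis using d by (auto simp: repeat_p_level)
    qed (use d in \<open>simp add: prims_def\<close>)
  qed (auto simp: prims_def repeat_p_level)
  moreover have "prims p nu k \<inter> repeat_mset p ` level p nu (Suc k) = {}"
    by (auto simp: prims_def)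
  moreover have "inj_on (repeat_mset p) (level p nu (Suc k))"
    using p by (intro inj_onI) (simp add: repeat_mset_cancel1)
  moreover have "finite (prims p nu k)" using level_finite by (simp add: prims_def)
  ultimately show ?thesis
    using card_Un_disjoint[of "prims p nu k" "repeat_mset p ` level p nu (Suc k)"] level_finite
    by (simp add: card_image)
qed

lemma gens_subset: "gens p nu i \<subseteq> level p nu 0"
  using level_antimono[OF p, of 0 "i - 1" nu] by (auto simp: gens_def)

lemma gens_finite: "finite (gens p nu i)"
  using gens_subset fin0 finite_subset by blast

text \<open>Counting \<open>prims\<close> in two consecutive levels gives the second difference. The
  set \<open>?E\<close> removed from it consists of the exponents of degree 1: \<open>{#j#}\<close>
  leaves the box at step \<open>nu j\<close> exactly.\<close>

lemma card_gens:
  assumes i: "i \<ge> 1"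
  shows "int (card (gens p nu i)) = int (card (level p nu (i - 1))) - 2 * int (card (level p nu i))
    + int (card (level p nu (Suc i))) - int (card {j. nu j = i})"
proof -
  let ?U = "prims p nu (i - 1) - prims p nu i" and ?E = "(\<lambda>j. {#j#}) ` {j. nu j = i}"
  have sub: "prims p nu i \<subseteq> prims p nu (i - 1)"
    using level_antimono[OF p, of "i - 1" i nu] by (auto simp: prims_def)
  have fin: "finite (prims p nu k)" for k
    using level_finite by (simp add: prims_def)
  have U: "?U = {d \<in> level p nu (i - 1) - level p nu i. \<exists>j. \<not> p dvd count d j}"
    by (auto simp: prims_def)
  have E: "?E \<subseteq> ?U"
  proof
    fix d assume "d \<in> ?E"
    then obtain j where j: "d = {#j#}" "nu j = i" by blast
    have "p ^ (i - 1) < p ^ i" using i p by (intro power_strict_increasing) auto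
    then have "d \<in> level p nu (i - 1)" using j p by (auto simp: level_def)
    moreover have "d \<notin> level p nu i" using j by (auto simp: level_def intro!: exI[of _ j])
    moreover have "\<not> p dvd count d j" using j p by simp
    ultimately show "d \<in> ?U" unfolding U by blast
  qed
  have "gens p nu i = ?U - ?E"
  proof (intro equalityI subsetI)
    fix d assume "d \<in> gens p nu i"
    then show "d \<in> ?U - ?E" unfolding U gens_def by auto
  next
    fix d assume d: "d \<in> ?U - ?E"
    have "size d \<noteq> 1"
    proof
      assume "size d = 1"
      then obtain j where j: "d = {#j#}" using size_1_singleton_mset by blast
      have "p ^ (i - 1) * count d j < p ^ nu j" using d unfolding U level_def by blast
      then have "p ^ (i - 1) < p ^ nu j" using j by simp
      then have lo: "i - 1 < nu j" using p by (metis power_strict_increasing_iff)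
      obtain j' where j': "p ^ nu j' \<le> p ^ i * count d j'"
        using d unfolding U level_def by (auto simp: not_less)
      have "j' = j"
      proof (rule ccontr)
        assume "j' \<noteq> j"
        with j' j have "p ^ nu j' \<le> 0" by simp
        then show False using p by simp
      qed
      with j' j have "p ^ nu j \<le> p ^ i" by simp
      then have "nu j \<le> i" using p by (metis power_increasing_iff)
      with lo have "nu j = i" by linarith
      then show False using d j by blast
    qed
    then show "d \<in> gens p nu i" using d unfolding U gens_def by blast
  qed
  then have "card (gens p nu i) + card ?E = card ?U"
    using E fin by (metis card_Diff_subset card_mono finite_Diff finite_subset le_add_diff_inverse2)
  moreover have "card ?E = card {j. nu j = i}"
    by (intro card_image) (auto simp: inj_on_def)
  moreover have "card ?U + card (prims p nu i) = card (prims p nu (i - 1))"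
    using sub fin by (metis card_Diff_subset card_mono le_add_diff_inverse2)
  moreover have "card (prims p nu (i - 1)) + card (level p nu i) = card (level p nu (i - 1))"
    using card_prims[of "i - 1"] i by simp
  moreover have "card (prims p nu i) + card (level p nu (Suc i)) = card (level p nu i)"
    by (rule card_prims)
  ultimately show ?thesis by linarith
qed

lemma gens_empty: 
  assumes "i > n" shows "gens p nu i = {}"
proof -
  have "level p nu (i - 1) \<subseteq> {{#}}"
    using level_antimono[OF p, of n "i - 1" nu] top assms by simp
  then show ?thesis by (auto simp: gens_def)
qed

text \<open>The exponent a is recovered as the largest one for which its power of p divides all
  entries.\<close>

lemma repeat_prim_unique:
  fixes d d' :: "nat multiset"
  assumes "repeat_mset (p ^ a) d = repeat_mset (p ^ b) d'"
    and "\<exists>j. \<not> p dvd count d j" "\<exists>j. \<not> p dvd count d' j"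
  shows "a = b \<and> d = d'"
proof -
  have le: "a \<le> b" if eq: "repeat_mset (p ^ a) d = repeat_mset (p ^ b) d'" and d': "\<exists>j. \<not> p dvd count d' j"
    for a b and d d' :: "nat multiset"
  proof (rule ccontr)
    assume "\<not> a \<le> b"
    then obtain c where c: "a = b + Suc c" by (metis add_Suc_right less_iff_Suc_add not_le)
    have "p ^ b * (p * p ^ c * count d j) = p ^ b * count d' j" for j
      using arg_cong[OF eq, of "\<lambda>M. count M j"] by (simp add: c power_add mult_ac)
    then have "p * p ^ c * count d j = count d' j" for j using p by simp
    then have "p dvd count d' j" for j by (metis dvd_triv_left mult.assoc)
    with d' show False by blast
  qed
  have "a = b" using le[OF assms(1,3)] le[OF assms(1)[symmetric] assms(2)] by simp
  then show ?thesis using assms(1) p by (simp add: repeat_mset_cancel1)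
qed

lemma tops_eq: "tops p nu = (\<Union>i\<in>{1..n}. repeat_mset (p ^ (i - 1)) ` gens p nu i)"
proof -
  have "gens p nu i = {}" if "i \<in> {1..}" "i \<notin> {1..n}" for i using gens_empty that by auto
  then show ?thesis unfolding tops_def by force
qed

text \<open>Each top comes from a single generator, since primitive parts are unique. Hence every
  generator with p-power exponent i replaces exactly one extra, on which the final comparison of
  orders depends.\<close>

lemma card_tops: "card (tops p nu) = (\<Sum>i=1..n. card (gens p nu i))"
proof -
  have "card (tops p nu) = (\<Sum>i=1..n. card (repeat_mset (p ^ (i - 1)) ` gens p nu i))"
    unfolding tops_eq
  proof (rule card_UN_disjoint)
    show "\<forall>i\<in>{1..n}. \<forall>j\<in>{1..n}. i \<noteq> j \<longrightarrow>
      repeat_mset (p ^ (i - 1)) ` gens p nu i \<inter> repeat_mset (p ^ (j - 1)) ` gens p nu j = {}"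
    proof (intro ballI impI equals0I)
      fix i j d assume *: "i \<in> {1..n}" "j \<in> {1..n}" "i \<noteq> j"
        "d \<in> repeat_mset (p ^ (i - 1)) ` gens p nu i \<inter> repeat_mset (p ^ (j - 1)) ` gens p nu j"
      then obtain d1 d2 where "d = repeat_mset (p ^ (i - 1)) d1" "d1 \<in> gens p nu i"
        "d = repeat_mset (p ^ (j - 1)) d2" "d2 \<in> gens p nu j" by blast
      then have "i - 1 = j - 1" using repeat_prim_unique[of "i - 1" d1 "j - 1" d2]
        by (simp add: gens_def)
      then show False using * by auto
    qed
  qed (use gens_finite in auto)
  also have "\<dots> = (\<Sum>i=1..n. card (gens p nu i))"
    using p by (intro sum.cong card_image) (auto intro!: inj_onI simp: repeat_mset_cancel1)
  finally show ?thesis .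
qed

lemma tops_subset: "tops p nu \<subseteq> level p nu 0 - {{#}}"
proof
  fix d assume "d \<in> tops p nu"
  then obtain i d' where d': "i \<ge> 1" "d' \<in> gens p nu i" "d = repeat_mset (p ^ (i - 1)) d'"
    by (auto simp: tops_def)
  then have "d' \<noteq> {#}" by (auto simp: gens_def)
  then have "d \<noteq> {#}" using d' p by (simp add: repeat_mset_eq_empty_iff)
  moreover have "d \<in> level p nu 0" using d' by (simp add: gens_def level_def)
  ultimately show "d \<in> level p nu 0 - {{#}}" by simp
qed

lemma extras_finite: "finite (extras p nu)"
  using fin0 by (simp add: extras_def)

lemma card_extras:
  "int (card (extras p nu)) = int (card (level p nu 0)) - 1 - (\<Sum>i=1..n. int (card (gens p nu i)))"
proof -
  have "{#} \<in> level p nu 0" using p by (simp add: level_def)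
  then have "card (level p nu 0 - {{#}}) + 1 = card (level p nu 0)"
    using fin0 by (metis Suc_eq_plus1 card_Suc_Diff1)
  moreover have "card (extras p nu) + card (tops p nu) = card (level p nu 0 - {{#}})"
    using tops_subset fin0 unfolding extras_def
    by (metis card_Diff_subset card_mono finite_Diff finite_subset le_add_diff_inverse2)
  ultimately show ?thesis unfolding card_tops of_nat_sum[symmetric] by linarith
qed

end

text \<open>Summation by parts. For a(i) = |G^(p^i)| the boundary values a(n) = a(n+1) = 1 turn the
  right-hand side into |G| - 1.\<close>

lemma sum_second_difference:
  fixes a :: "nat \<Rightarrow> int"
  shows "(\<Sum>i=1..n. int i * (a (i - 1) - 2 * a i + a (Suc i))) = a 0 - (int n + 1) * a n + int n * a (Suc n)"
  by (induction n) (simp_all add: algebra_simps)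

text \<open>Indices beyond the end of the list contribute the identity.\<close>

definition (in comm_group) gs_prod :: "'a list \<Rightarrow> nat multiset \<Rightarrow> 'a" where
  "gs_prod gs M = finprod G (\<lambda>j. (gs ! j) [^] count M j) {..<length gs}"

section \<open>Exponents and elements of a product of cyclic groups\<close>

locale decomposed_group = comm_group G for G (structure) +
  fixes gs :: "'a list" and p :: nat and nu :: "nat \<Rightarrow> nat"
  assumes p: "p > 1" and finG: "finite (carrier G)"
    and decomp: "cyclic_decomposition G gs"
    and ord_nu: "j < length gs \<Longrightarrow> ord (gs ! j) = p ^ nu j"
    and nu_0: "j \<ge> length gs \<Longrightarrow> nu j = 0"
begin

lemma gs_closed [simp]: "j < length gs \<Longrightarrow> gs ! j \<in> carrier G"
  using decomp by (auto simp: cyclic_decomposition_def)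

abbreviation "ev \<equiv> gs_prod gs"

lemma ev_in [simp]: "ev M \<in> carrier G"
  unfolding gs_prod_def by (intro finprod_closed) auto

lemma ev_empty: "ev {#} = \<one>"
  unfolding gs_prod_def by (simp add: finprod_one_eqI)

lemma ev_plus: "ev (M + N) = ev M \<otimes> ev N"
proof -
  have "ev (M + N) = finprod G (\<lambda>j. (gs ! j) [^] count M j \<otimes> (gs ! j) [^] count N j) {..<length gs}"
    unfolding gs_prod_def by (intro finprod_cong') (auto simp: nat_pow_mult)
  then show ?thesis
    unfolding gs_prod_def by (subst (asm) finprod_multf) auto
qed

lemma ev_repeat: "ev (repeat_mset k M) = ev M [^] k"
  by (induction k) (simp_all add: ev_empty ev_plus m_comm)

lemma pow_eq_mod: "j < length gs \<Longrightarrow> (gs ! j) [^] (a mod p ^ nu j) = (gs ! j) [^] (a::nat)"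
  using int_pow_mod_order[of "gs ! j" "p ^ nu j" "int a"] pow_ord_eq_1[of "gs ! j"]
  by (simp add: ord_nu int_pow_int flip: of_nat_mod of_nat_power)

definition collect :: "(nat \<Rightarrow> nat) \<Rightarrow> nat multiset" where
  "collect c = (\<Sum>j<length gs. replicate_mset (c j) j)"

lemma count_collect: "count (collect c) j = (if j < length gs then c j else 0)"
  by (simp add: collect_def count_sum if_distrib cong: if_cong)

lemma ev_cong: "(\<And>j. j < length gs \<Longrightarrow> count M j mod p ^ nu j = count N j mod p ^ nu j) \<Longrightarrow> ev M = ev N"
  unfolding gs_prod_def by (intro finprod_cong') (auto, metis pow_eq_mod)

lemma subgroup_generated_carrier:
  assumes "j < length gs"
  shows "carrier (subgroup_generated G {gs ! j}) = range (\<lambda>k::nat. (gs ! j) [^] k)"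
proof -
  have "carrier (subgroup_generated G {gs ! j}) = generate G {gs ! j}"
    using assms by (simp add: subgroup_generated_def)
  also have "\<dots> = range (\<lambda>k::nat. (gs ! j) [^] k)"
    using generate_pow_on_finite_carrier[OF finG, of "gs ! j"] assms by auto
  finally show ?thesis .
qed

lemma iso_decomp:
  "bij_betw (\<lambda>h. finprod G h {..<length gs})
    (\<Pi>\<^sub>E j\<in>{..<length gs}. carrier (subgroup_generated G {gs ! j})) (carrier G)"
  using decomp by (simp add: cyclic_decomposition_def iso_def)

lemma ev_restrict: "ev M = finprod G (\<lambda>j\<in>{..<length gs}. (gs ! j) [^] count M j) {..<length gs}"
  unfolding gs_prod_def by (intro finprod_cong') auto

text \<open>Components in a direct product are unique, and so are exponents below the order of each
  generator. Past the end of the list \<open>nu j = 0\<close> leaves only the count 0.\<close>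

lemma ev_bij: "bij_betw ev (level p nu 0) (carrier G)"
  unfolding bij_betw_def
proof
  show "inj_on ev (level p nu 0)"
  proof
    fix d d' assume d: "d \<in> level p nu 0" "d' \<in> level p nu 0" "ev d = ev d'"
    let ?r = "\<lambda>d. \<lambda>j\<in>{..<length gs}. (gs ! j) [^] count d j"
    have "?r d = ?r d'"
    proof (rule inj_onD[OF bij_betw_imp_inj_on[OF iso_decomp]])
      show "finprod G (?r d) {..<length gs} = finprod G (?r d') {..<length gs}"
        using d(3) by (simp only: ev_restrict)
    qed (auto simp: subgroup_generated_carrier)
    then have eq: "(gs ! j) [^] count d j = (gs ! j) [^] count d' j" if "j < length gs" for j
      using that by (auto simp: fun_eq_iff split: if_splits)
    show "d = d'"
    proof (rule multiset_eqI)
      fix j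
      have c: "count d j < p ^ nu j" "count d' j < p ^ nu j" using d by (auto simp: level_def)
      show "count d j = count d' j"
      proof (cases "j < length gs")
        case True
        have "inj_on (\<lambda>x. (gs ! j) [^] x) {0 .. ord (gs ! j) - 1}"
          using True by (intro ord_inj) simp
        then show ?thesis
          using eq[OF True] c unfolding ord_nu[OF True] by (auto simp: inj_on_def)
      next
        case False
        then show ?thesis using c nu_0[of j] by simp
      qed
    qed
  qed
  show "ev ` level p nu 0 = carrier G"
  proof (intro equalityI subsetI)
    fix g assume "g \<in> carrier G"
    then obtain h where h: "h \<in> (\<Pi>\<^sub>E j\<in>{..<length gs}. carrier (subgroup_generated G {gs ! j}))"
      "g = finprod G h {..<length gs}"
      using iso_decomp unfolding bij_betw_def by blast
    have "\<forall>j\<in>{..<length gs}. \<exists>k::nat. h j = (gs ! j) [^] k"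
      using h(1) subgroup_generated_carrier by (fastforce simp: PiE_iff)
    then obtain k :: "nat \<Rightarrow> nat" where k: "\<And>j. j < length gs \<Longrightarrow> h j = (gs ! j) [^] k j"
      by (metis lessThan_iff)
    define d where "d = collect (\<lambda>j. k j mod p ^ nu j)"
    have "g = ev d"
      unfolding h(2) gs_prod_def d_def
      by (intro finprod_cong') (auto simp: k count_collect pow_eq_mod)
    moreover have "d \<in> level p nu 0"
      using p by (auto simp: level_def d_def count_collect)
    ultimately show "g \<in> ev ` level p nu 0" by blast
  qed auto
qed

lemma level_0_finite: "finite (level p nu 0)"
  using bij_betw_finite[OF ev_bij] finG by simp

lemma card_level_0: "card (level p nu 0) = card (carrier G)"
  by (rule bij_betw_same_card[OF ev_bij])

text \<open>A \<open>p ^ i\<close>-th power has an exponent p^i d, and reducing it into the box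
  again gives a multiple of p^i, so it is p^i c for a unique c in level i.\<close>

lemma card_power_subset: "card (power_subset G (p ^ i)) = card (level p nu i)"
proof -
  have "bij_betw (\<lambda>d. ev (repeat_mset (p ^ i) d)) (level p nu i) (power_subset G (p ^ i))"
    unfolding bij_betw_def
  proof
    have "inj_on (repeat_mset (p ^ i)) (level p nu i)"
      using p by (intro inj_onI) (simp add: repeat_mset_cancel1)
    moreover have "repeat_mset (p ^ i) ` level p nu i \<subseteq> level p nu 0"
      by (auto simp: level_def)
    ultimately show "inj_on (\<lambda>d. ev (repeat_mset (p ^ i) d)) (level p nu i)"
      using comp_inj_on[of "repeat_mset (p ^ i)" "level p nu i" ev] ev_bij
      by (auto simp: bij_betw_def comp_def intro: inj_on_subset)
    show "(\<lambda>d. ev (repeat_mset (p ^ i) d)) ` level p nu i = power_subset G (p ^ i)"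
    proof (intro equalityI subsetI)
      fix g assume "g \<in> power_subset G (p ^ i)"
      then obtain x where x: "x \<in> carrier G" "g = x [^] (p ^ i)" by (auto simp: power_subset_def)
      then obtain d where d: "x = ev d" using ev_bij by (auto simp: bij_betw_def)
      define c where "c = collect (\<lambda>j. (p ^ i * count d j mod p ^ nu j) div p ^ i)"
      have c: "p ^ i * count c j = p ^ i * count d j mod p ^ nu j" if "j < length gs" for j
      proof -
        \<comment> \<open>Either p^i divides the modulus and therefore the remainder, or the modulus
          divides p^i and the remainder is 0.\<close>
        have "p ^ i dvd p ^ i * count d j mod p ^ nu j"
        proof (cases "i \<le> nu j")
          case True
          then show ?thesis by (intro dvd_mod) (auto simp: le_imp_power_dvd)
        next
          case False
          then have "p ^ nu j dvd p ^ i * count d j" by (intro dvd_mult2 le_imp_power_dvd) auto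
          then show ?thesis by simp
        qed
        then show ?thesis using that by (simp add: c_def count_collect)
      qed
      have "c \<in> level p nu i"
        unfolding level_def
      proof (intro CollectI allI)
        fix j
        show "p ^ i * count c j < p ^ nu j"
          using c[of j] p by (cases "j < length gs") (auto simp: c_def count_collect)
      qed
      moreover have "ev (repeat_mset (p ^ i) c) = ev (repeat_mset (p ^ i) d)"
        by (rule ev_cong) (simp add: c)
      then have "g = ev (repeat_mset (p ^ i) c)" using x d by (simp add: ev_repeat)
      ultimately show "g \<in> (\<lambda>d. ev (repeat_mset (p ^ i) d)) ` level p nu i" by blast
    qed (auto simp: power_subset_def ev_repeat)
  qed
  then show ?thesis by (metis bij_betw_same_card)
qed

lemma card_carrier: "card (carrier G) = p ^ (\<Sum>j<length gs. nu j)"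
proof -
  have "card (carrier G) = card (\<Pi>\<^sub>E j\<in>{..<length gs}. carrier (subgroup_generated G {gs ! j}))"
    using bij_betw_same_card[OF iso_decomp] by simp
  also have "\<dots> = (\<Prod>j<length gs. card (carrier (subgroup_generated G {gs ! j})))"
    by (simp add: card_PiE)
  also have "\<dots> = (\<Prod>j<length gs. p ^ nu j)"
  proof (rule prod.cong)
    fix j assume "j \<in> {..<length gs}"
    then have j: "j < length gs" by simp
    have "carrier (subgroup_generated G {gs ! j}) = generate G {gs ! j}"
      using j by (simp add: subgroup_generated_def)
    then show "card (carrier (subgroup_generated G {gs ! j})) = p ^ nu j"
      using generate_pow_card[of "gs ! j"] j by (simp add: ord_nu)
  qed simp
  finally show ?thesis by (simp add: power_sum)
qed

end

section \<open>The decomposition\<close>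

lemma prod_list_concat_replicate:
  "prod_list (concat (map (\<lambda>i. replicate (c i) (p ^ f i)) is)) = (p::nat) ^ (\<Sum>i\<leftarrow>is. c i * f i)"
  by (induction "is") (simp_all add: power_add mult.commute flip: power_mult)

locale group_ring_units = decomposed_group G gs p nu for G (structure) and gs p nu +
  fixes e n :: nat
  assumes prime: "Factorial_Ring.prime p" and e: "e \<ge> 1"
    and exponent: "\<And>j. nu j \<le> n"
begin

sublocale group_ring_hom G ev "p ^ e"
proof unfold_locales
  show "finite (carrier G)" by (rule finG)
  show "range ev = carrier G" using ev_bij by (auto simp: bij_betw_def)
  show "p ^ e > 1" using p e by (intro one_less_power) auto
qed (simp_all add: ev_empty ev_plus)

abbreviation y :: "nat \<Rightarrow> nat multiset \<Rightarrow>\<^sub>0 int" where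
  "y j \<equiv> Poly_Mapping.single {#j#} 1 - 1"

lemma single_power: "Poly_Mapping.single {#j#} (1::int) ^ k = Poly_Mapping.single (replicate_mset k j) 1"
  by (induction k) (simp_all add: mult_single)

lemma level_top: "level p nu n = {{#}}"
proof (intro equalityI subsetI)
  fix d assume d: "d \<in> level p nu n"
  have "count d j = 0" for j
  proof -
    have "p ^ n * count d j < p ^ nu j" using d by (simp add: level_def)
    also have "\<dots> \<le> p ^ n * 1" using p exponent by (simp add: power_increasing)
    finally show ?thesis using p by simp
  qed
  then show "d \<in> {{#}}" by (simp add: multiset_eq_iff)
qed (use p in \<open>simp add: level_def\<close>)

sublocale presentation y p e nu kernel
proof unfold_locales
  show "Factorial_Ring.prime p" by (rule prime)
  show "e \<ge> 1" by (rule e)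
  show "a + b \<in> kernel" if "a \<in> kernel" "b \<in> kernel" for a b using that by (rule kernel_add)
  show "r * a \<in> kernel" if "a \<in> kernel" for a r using that by (rule kernel_mult)
  show "of_nat p ^ e \<in> kernel" using kernel_modulus by simp
  show "(1 + y j) ^ (p ^ nu j) - 1 \<in> kernel" for j
  proof -
    have "ev (replicate_mset (p ^ nu j) j) = ev {#}"
      by (rule ev_cong) simp
    from kernel_single[OF this, of 1] show ?thesis
      by (simp add: single_power)
  qed
  show "finite {j. nu j \<noteq> 0}"
    by (rule finite_subset[of _ "{..<length gs}"]) (use nu_0 in \<open>auto intro: ccontr simp: not_less\<close>)
qed

lemma single_minus_one_aug: "Poly_Mapping.single M 1 - 1 \<in> aug y (Suc 0)"
proof (induction M)
  case (add j M)
  have "Poly_Mapping.single (add_mset j M) 1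
      = Poly_Mapping.single {#j#} (1::int) * Poly_Mapping.single M 1"
    by (simp add: mult_single)
  then have "Poly_Mapping.single (add_mset j M) 1 - 1
      = (Poly_Mapping.single M 1 - 1) + y j * (Poly_Mapping.single M 1 - 1) + y j"
    by (simp add: algebra_simps)
  moreover have "y j * (Poly_Mapping.single M 1 - 1) \<in> aug y (Suc 0)"
    using add aug_0[OF aug_y] by (intro aug_mult_0)
  ultimately show ?case 
    using aug_add[OF aug_y[of y j] aug_add[OF _ add]] by (simp only:)
qed (simp add: aug.zero)

text \<open>By linearity only x^M - 1 has to be considered, for monomials x^M in the generators.
  This links the augmentation, by which units are defined, to the degree in the y(j), by which they
  are filtered.\<close>

lemma minus_total_aug: "P - of_int (total P) \<in> aug y (Suc 0)"
proof (induction P rule: poly_mapping_single_induct)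
  case (single M c)
  have "of_int c * (Poly_Mapping.single M 1 - 1) \<in> aug y (Suc 0)"
    by (intro aug_mult_0 single_minus_one_aug) simp
  then show ?case
    unfolding total_single by (subst single_mult_of_int) (simp add: right_diff_distrib)
next
  case (add a b)
  then have "(a - of_int (total a)) + (b - of_int (total b)) \<in> aug y (Suc 0)" by (intro aug_add)
  then show ?case by (simp add: algebra_simps)
qed

lemma total_fil:
  assumes "total u mod int (p ^ e) = 1 mod int (p ^ e)"
  shows "u - 1 \<in> fil 0 (Suc 0)"
proof -
  have "int (p ^ e) dvd total u - 1" using assms by (simp only: mod_eq_dvd_iff)
  then obtain t where t: "total u - 1 = int (p ^ e) * t" by (rule dvdE)
  have "of_int (total u) - 1 = (of_int (total u - 1) :: nat multiset \<Rightarrow>\<^sub>0 int)" by simp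
  also have "\<dots> = of_nat p ^ e * of_int t" unfolding t by simp
  finally have "of_int (total u) - 1 \<in> kernel" using J_p J_mult' by simp
  then have "of_int (total u) - 1 \<in> fil 0 (Suc 0)" by (rule fil_J)
  moreover have "u - of_int (total u) \<in> fil 0 (Suc 0)"
    using fil_aug[OF minus_total_aug, of 0] by simp
  ultimately have "(u - of_int (total u)) + (of_int (total u) - 1) \<in> fil 0 (Suc 0)"
    by (intro fil_add)
  then show ?thesis by simp
qed

text \<open>Discharges the assumption under which the normalized units were shown to form a
  group.\<close>

lemma torsion: "\<forall>u. total u mod int (p ^ e) = 1 mod int (p ^ e) \<longrightarrow> (\<exists>k>0. u ^ k - 1 \<in> kernel)"
  using unit_order total_fil by blast

abbreviation "V \<equiv> normalized_units G (p ^ e)"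

lemmas V_carrier = normalized_units_carrier[OF torsion]
lemmas V_mult = normalized_units_mult
lemmas V_pow = normalized_units_pow[OF torsion]
lemmas V_comm_group = normalized_units_comm_group[OF torsion]

lemma total_mon: "d \<noteq> {#} \<Longrightarrow> total (mon y d) = 0"
  by (cases d) (simp_all add: mon_def)

lemma proj_torsion:
  assumes "total u = 1" "u ^ k - 1 \<in> kernel"
  shows "proj u \<in> carrier V \<and> proj u [^]\<^bsub>V\<^esub> k = \<one>\<^bsub>V\<^esub>"
  using assms by (simp add: proj_in_normalized_units[OF torsion] V_pow normalized_units_one proj_eq_iff)

lemma gr_basis_subgroup: "subgroup (gr_basis G (p ^ e) ` carrier G) V"
proof -
  interpret V: comm_group V by (rule V_comm_group)
  have "gr_basis G (p ^ e) \<in> hom G V"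
    unfolding hom_def
  proof (intro CollectI conjI ballI funcsetI)
    fix x assume x: "x \<in> carrier G"
    have "gr_basis G (p ^ e) x = proj (Poly_Mapping.single (sec x) 1)"
      using x by (simp add: proj_single ev_sec)
    then show "gr_basis G (p ^ e) x \<in> carrier V"
      by (simp add: proj_in_normalized_units[OF torsion])
    fix z assume z: "z \<in> carrier G"
    have "gr_basis G (p ^ e) (x \<otimes> z) = proj (Poly_Mapping.single (sec x + sec z) 1)"
      using x z by (simp add: proj_single ev_sec ev_plus)
    also have "\<dots> = proj (Poly_Mapping.single (sec x) 1 * Poly_Mapping.single (sec z) 1)"
      by (simp add: mult_single)
    also have "\<dots> = gr_basis G (p ^ e) x \<otimes>\<^bsub>V\<^esub> gr_basis G (p ^ e) z"
      using x z by (simp only: V_mult[symmetric] proj_single ev_sec)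
    finally show "gr_basis G (p ^ e) (x \<otimes> z) = gr_basis G (p ^ e) x \<otimes>\<^bsub>V\<^esub> gr_basis G (p ^ e) z" .
  qed
  then interpret h: group_hom G V "gr_basis G (p ^ e)"
    by unfold_locales
  show ?thesis by (rule h.img_is_subgroup)
qed

lemmas count_facts = p_gt_1 level_0_finite level_top

lemma splitting:
  "\<exists>L. internal_direct_product V (gr_basis G (p ^ e) ` carrier G) L \<and>
     V\<lparr>carrier := L\<rparr> \<cong> cyclic_product (replicate (card (extras p nu)) (p ^ (e - 1)) @
       concat (map (\<lambda>i. replicate (card (gens p nu i)) (p ^ (i + e - 1))) [1..<n + 1]))"
proof -
  interpret V: comm_group V by (rule V_comm_group)
  let ?A = "gr_basis G (p ^ e) ` carrier G"
  have "\<forall>i. \<exists>xs. set xs = gens p nu i \<and> distinct xs"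
    using finite_distinct_list gens_finite[OF count_facts] by blast
  then obtain xs where xs: "\<And>i. set (xs i) = gens p nu i" "\<And>i. distinct (xs i)" by metis
  obtain ys where ys: "set ys = extras p nu" "distinct ys"
    using finite_distinct_list extras_finite[OF count_facts] by blast
  \<comment> \<open>Each generator is paired with an exponent known to annihilate it, in the order
    in which the cyclic factors are listed in the claim.\<close>
  define bms where "bms = map (\<lambda>d. (proj (1 + of_nat p * mon y d), p ^ (e - 1))) ys @
    concat (map (\<lambda>i. map (\<lambda>d. (proj (1 + mon y d), p ^ (i + e - 1))) (xs i)) [1..<n + 1])"
  have len: "length (xs i) = card (gens p nu i)" "length ys = card (extras p nu)" for i
    using xs ys distinct_card by metis+
  have orders: "map snd bms = replicate (card (extras p nu)) (p ^ (e - 1)) @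
       concat (map (\<lambda>i. replicate (card (gens p nu i)) (p ^ (i + e - 1))) [1..<n + 1])"
    by (simp add: bms_def map_concat comp_def len map_replicate_const)
  have set_bms: "set bms = (\<lambda>d. (proj (1 + of_nat p * mon y d), p ^ (e - 1))) ` extras p nu \<union>
    (\<Union>i\<in>{1..n}. (\<lambda>d. (proj (1 + mon y d), p ^ (i + e - 1))) ` gens p nu i)"
  proof -
    have "set [1..<n + 1] = {1..n}" by auto
    then show ?thesis
      by (simp only: bms_def set_append set_concat set_map xs ys image_image)
  qed
  have gens_ne: "d \<noteq> {#}" if "d \<in> gens p nu i" for d i using that by (auto simp: gens_def)
  have "\<exists>L. internal_direct_product V ?A L \<and> V\<lparr>carrier := L\<rparr> \<cong> cyclic_product (map snd bms)"
  proof (rule direct_complement)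
    show "comm_group V" by (rule V_comm_group)
    have card_V: "card (carrier V) = (p ^ e) ^ (card (carrier G) - 1)"
      unfolding V_carrier by (rule card_augmentation_one)
    then show "finite (carrier V)" using p_gt_1 by (intro card_ge_0_finite) simp
    show "subgroup ?A V" by (rule gr_basis_subgroup)
    show "b \<in> carrier V \<and> m > 0 \<and> b [^]\<^bsub>V\<^esub> m = \<one>\<^bsub>V\<^esub>" if "(b, m) \<in> set bms" for b m
      using that unfolding set_bms
    proof (elim UnE imageE UN_E)
      fix d assume d: "(b, m) = (proj (1 + of_nat p * mon y d), p ^ (e - 1))" "d \<in> extras p nu"
      then have "d \<noteq> {#}" by (auto simp: extras_def)
      then have s: "Suc 0 \<le> size d" by (cases "size d") auto
      have "(1 + of_nat p * mon y d) ^ (p ^ (e - 1)) - 1 \<in> kernel"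
        using fil_aug[OF aug_mon[OF s], of 1] by (intro fil_1_order) simp
      moreover have "total (1 + of_nat p * mon y d) = 1"
        using \<open>d \<noteq> {#}\<close> by (simp add: total_mon)
      ultimately show ?thesis
        using d(1) p_gt_1 by (simp add: proj_torsion)
    next
      fix i d assume d: "i \<in> {1..n}" "(b, m) = (proj (1 + mon y d), p ^ (i + e - 1))" "d \<in> gens p nu i"
      have "(1 + mon y d) ^ (p ^ (i + e - 1)) - 1 \<in> kernel"
        using d by (intro gens_order) auto
      moreover have "total (1 + mon y d) = 1"
        using gens_ne[OF d(3)] by (simp add: total_mon)
      ultimately show ?thesis
        using d(2) p_gt_1 by (simp add: proj_torsion)
    qed
    show "carrier V \<subseteq> S"
      if A: "?A \<subseteq> S" and b: "fst ` set bms \<subseteq> S"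
        and mult: "\<And>x z. x \<in> S \<Longrightarrow> z \<in> S \<Longrightarrow> x \<otimes>\<^bsub>V\<^esub> z \<in> S" for S
    proof
      fix x assume x: "x \<in> carrier V"
      \<comment> \<open>The approximation yields a product h of generators with u h = 1, so u is
        chosen to represent the inverse of x; then h represents x itself.\<close>
      then have "inv\<^bsub>V\<^esub> x \<in> carrier V" by simp
      then obtain u where u: "inv\<^bsub>V\<^esub> x = proj u" "total u mod int (p ^ e) = 1 mod int (p ^ e)"
        by (rule normalized_unitsE[OF torsion])
      have single_S: "proj (Poly_Mapping.single M 1) \<in> S" for M
        using A by (auto simp: proj_single)
      have "\<exists>h\<in>{h. proj h \<in> S}. u * h - 1 \<in> kernel"
      proof (rule units_generated)
        show "1 \<in> {h. proj h \<in> S}" using single_S[of "{#}"] by simp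
        show "g * h \<in> {h. proj h \<in> S}" if "g \<in> {h. proj h \<in> S}" "h \<in> {h. proj h \<in> S}" for g h
          using that mult by (simp flip: V_mult)
        show "1 + y j \<in> {h. proj h \<in> S}" for j
          using single_S[of "{#j#}"] by simp
        show "1 + mon y d \<in> {h. proj h \<in> S}" if "i \<ge> 1" "d \<in> gens p nu i" for i d
        proof -
          have "i \<le> n" using gens_empty[OF count_facts, of i] that by (auto simp: not_less[symmetric])
          then have "(proj (1 + mon y d), p ^ (i + e - 1)) \<in> set bms"
            using that unfolding set_bms by auto
          then show ?thesis using b by force
        qed
        show "1 + of_nat p * mon y d \<in> {h. proj h \<in> S}" if "d \<in> extras p nu" for d
        proof -
          have "(proj (1 + of_nat p * mon y d), p ^ (e - 1)) \<in> set bms"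
            using that unfolding set_bms by auto
          then show ?thesis using b by force
        qed
        show "u - 1 \<in> fil 0 (Suc 0)" using u(2) by (rule total_fil)
      qed
      then obtain h where h: "proj h \<in> S" "u * h - 1 \<in> kernel" by blast
      from h(2) have "inv\<^bsub>V\<^esub> x \<otimes>\<^bsub>V\<^esub> proj h = \<one>\<^bsub>V\<^esub>"
        unfolding u(1) V_mult normalized_units_one proj_eq_iff .
      moreover have "proj h \<in> carrier V"
      proof (rule proj_in_normalized_units[OF torsion])
        have "proj (u * h) = proj 1" using h(2) by (simp only: proj_eq_iff)
        then have "total (u * h) mod int (p ^ e) = total 1 mod int (p ^ e)"
          by (metis proj_augmentation)
        then have "(total u * total h) mod int (p ^ e) = 1 mod int (p ^ e)" by simp
        moreover have "(total u * total h) mod int (p ^ e) = (1 * total h) mod int (p ^ e)"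
          using u(2) by (rule mod_mult_cong) (rule refl)
        ultimately show "total h mod int (p ^ e) = 1 mod int (p ^ e)" by simp
      qed
      ultimately have "proj h = x"
        using x by (metis V.inv_closed V.inv_inv V.inv_equality V.m_comm)
      then show "x \<in> S" using h(1) by simp
    qed
    show "card ?A * prod_list (map snd bms) = card (carrier V)"
    proof -
      let ?g = "\<lambda>i. card (gens p nu i)" and ?x = "card (extras p nu)"
        and ?t = "\<lambda>i. card {j. nu j = i}" and ?N = "\<Sum>j<length gs. nu j" and ?c = "card (carrier G)"
      have "prod_list (map snd bms) = p ^ ((e - 1) * ?x + (\<Sum>i=1..n. ?g i * (i + e - 1)))"
      proof -
        have "set [1..<n + 1] = {1..n}" by auto
        then have "(\<Sum>i\<leftarrow>[1..<n + 1]. ?g i * (i + e - 1)) = (\<Sum>i=1..n. ?g i * (i + e - 1))"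
          by (simp only: interv_sum_list_conv_sum_set_nat)
        then show ?thesis
          unfolding orders prod_list.append prod_list_replicate prod_list_concat_replicate
          by (simp only: power_add power_mult)
      qed
      moreover have "card ?A = p ^ ?N"
        using card_image[OF gr_basis_inj] card_carrier by simp
      \<comment> \<open>There are |G| - 1 generators outside G in all, each contributing e - 1. The
        additional i of the generators in \<open>gens\<close> sum to |G| - 1 - N by summation by
        parts, and the N from |G| itself completes e (|G| - 1).\<close>
      moreover have "?N + ((e - 1) * ?x + (\<Sum>i=1..n. ?g i * (i + e - 1))) = e * (?c - 1)"
      proof -
        have c1: "?c \<ge> 1" using card_carrier p_gt_1 by simp
        \<comment> \<open>Indices are grouped by the value of \<open>nu\<close>; those with value 0
          contribute nothing to the left side.\<close>
        have N: "?N = (\<Sum>i=1..n. i * ?t i)"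
        proof -
          have "?N = (\<Sum>j<length gs. \<Sum>i=1..n. if nu j = i then i else 0)"
            using exponent by (intro sum.cong) (auto simp: sum.delta)
          also have "\<dots> = (\<Sum>i=1..n. \<Sum>j<length gs. if nu j = i then i else 0)"
            by (rule sum.swap)
          also have "\<dots> = (\<Sum>i=1..n. i * ?t i)"
          proof (rule sum.cong)
            fix i assume i: "i \<in> {1..n}"
            have "{j. nu j = i} = {j \<in> {..<length gs}. nu j = i}"
              using i nu_0 by (auto intro: ccontr simp: not_less)
            then show "(\<Sum>j<length gs. if nu j = i then i else 0) = i * ?t i"
              by (simp add: sum.If_cases Int_def)
          qed simp
          finally show ?thesis .
        qed
        let ?a = "\<lambda>i. int (card (level p nu i))"
        have an: "?a n = 1" "?a (Suc n) = 1"
        proof -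
          have "{#} \<in> level p nu (Suc n)" using p_gt_1 by (simp add: level_def)
          then have "level p nu (Suc n) = {{#}}"
            using level_antimono[OF p_gt_1, of n "Suc n" nu] level_top by auto
          then show "?a n = 1" "?a (Suc n) = 1" using level_top by auto
        qed
        have "(\<Sum>i=1..n. int i * int (?g i))
            = (\<Sum>i=1..n. int i * (?a (i - 1) - 2 * ?a i + ?a (Suc i)) - int (i * ?t i))"
          by (intro sum.cong) (auto simp: card_gens[OF count_facts] algebra_simps)
        also have "\<dots> = int ?c - 1 - int ?N"
          unfolding sum_subtractf sum_second_difference[where a = ?a and n = n] N an card_level_0 by simp
        finally have 1: "(\<Sum>i=1..n. int i * int (?g i)) = int ?c - 1 - int ?N" .
        have 2: "int ?x = int ?c - 1 - (\<Sum>i=1..n. int (?g i))"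
          using card_extras[OF count_facts] by (simp add: card_level_0)
        have "int (\<Sum>i=1..n. ?g i * (i + e - 1))
            = (\<Sum>i=1..n. int i * int (?g i) + (int e - 1) * int (?g i))"
          unfolding of_nat_sum
        proof (rule sum.cong)
          fix i
          have "int (i + e - 1) = int i + (int e - 1)" using e by linarith
          then show "int (?g i * (i + e - 1)) = int i * int (?g i) + (int e - 1) * int (?g i)"
            unfolding of_nat_mult by (simp only: distrib_left mult.commute)
        qed simp
        also have "\<dots> = int ?c - 1 - int ?N + (int e - 1) * (\<Sum>i=1..n. int (?g i))"
          unfolding sum.distrib 1 sum_distrib_left ..
        finally have 3: "int (\<Sum>i=1..n. ?g i * (i + e - 1))
          = int ?c - 1 - int ?N + (int e - 1) * (\<Sum>i=1..n. int (?g i))" .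
        have "int (?N + ((e - 1) * ?x + (\<Sum>i=1..n. ?g i * (i + e - 1))))
            = int ?N + (int e - 1) * int ?x + int (\<Sum>i=1..n. ?g i * (i + e - 1))"
          using e by (simp add: of_nat_diff)
        also have "\<dots> = int e * (int ?c - 1)"
          unfolding 3 2 by (simp add: algebra_simps)
        also have "\<dots> = int (e * (?c - 1))" using c1 by (simp add: of_nat_diff)
        finally show ?thesis by (simp only: of_nat_eq_iff)
      qed
      ultimately show ?thesis
        unfolding card_V by (simp flip: power_add power_mult)
    qed
  qed
  then show ?thesis unfolding orders .
qed

end

theorem theorem2:
  fixes G :: "('a, 'b) monoid_scheme" and p e n :: nat and gs :: "'a list"
  assumes "Factorial_Ring.prime p" and "e \<ge> 1"
    and "comm_group G" and "finite (carrier G)"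
    and "\<exists>k. card (carrier G) = p ^ k"
    and "group_exponent G = p ^ n"
    and "cyclic_decomposition G gs"
  shows "let t = (\<lambda>i::nat. card {j. j < length gs \<and> group.ord G (gs ! j) = p ^ i});
             s = (\<lambda>i::nat. (int (card (power_subset G (p ^ (i - 1))))
                     - 2 * int (card (power_subset G (p ^ i)))
                     + int (card (power_subset G (p ^ (i + 1))))) - int (t i));
             l = int (card (carrier G)) - 1 - (\<Sum>i=1..n. s i);
             V = normalized_units G (p ^ e)
         in (\<forall>i\<in>{1..n}. s i \<ge> 0) \<and> l \<ge> 0 \<and>
            (\<exists>L. internal_direct_product V (gr_basis G (p ^ e) ` carrier G) L \<and>
                 V\<lparr>carrier := L\<rparr> \<cong>
                   cyclic_product (replicate (nat l) (p ^ (e - 1)) @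
                     concat (map (\<lambda>i. replicate (nat (s i)) (p ^ (i + e - 1))) [1..<n + 1])))"
proof -
  interpret comm_group G by fact
  have p1: "p > 1" using assms(1) by (rule prime_gt_1_nat)
  have closed: "gs ! j \<in> carrier G" if "j < length gs" for j
    using assms(7) that by (auto simp: cyclic_decomposition_def)
  have "\<exists>i\<le>n. ord (gs ! j) = p ^ i" if j: "j < length gs" for j
  proof -
    have "ord (gs ! j) dvd p ^ n"
      using closed[OF j] unfolding assms(6)[symmetric] group_exponent_def by (intro dvd_Lcm) simp
    then show ?thesis using assms(1) by (simp add: divides_primepow_nat)
  qed
  then obtain nu0 where nu0: "\<And>j. j < length gs \<Longrightarrow> nu0 j \<le> n \<and> ord (gs ! j) = p ^ nu0 j"
    by metis
  \<comment> \<open>The value 0 past the end of the list makes the surplus variables vanish in the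
    group ring. It does not disturb the numbers t(i), which are compared with \<open>nu\<close> for
    i \<ge> 1 only.\<close>
  define nu where "nu j = (if j < length gs then nu0 j else 0)" for j
  interpret U: group_ring_units G gs p nu e n
    by unfold_locales (use assms p1 nu0 in \<open>auto simp: nu_def\<close>)
  define t where "t = (\<lambda>i::nat. card {j. j < length gs \<and> group.ord G (gs ! j) = p ^ i})"
  define s where "s = (\<lambda>i::nat. (int (card (power_subset G (p ^ (i - 1))))
                     - 2 * int (card (power_subset G (p ^ i)))
                     + int (card (power_subset G (p ^ (i + 1))))) - int (t i))"
  define l where "l = int (card (carrier G)) - 1 - (\<Sum>i=1..n. s i)"
  have s: "s i = int (card (gens p nu i))" if "i \<ge> 1" for i
  proof -
    have "{j. nu j = i} = {j. j < length gs \<and> ord (gs ! j) = p ^ i}"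
      using that nu0 p1 by (auto simp: nu_def split: if_splits)
    then show ?thesis
      unfolding s_def t_def U.card_power_subset card_gens[OF U.count_facts that] by simp
  qed
  have l: "l = int (card (extras p nu))"
    using card_extras[OF U.count_facts] s by (simp add: l_def U.card_level_0)
  have "map (\<lambda>i. replicate (nat (s i)) (p ^ (i + e - 1))) [1..<n + 1]
      = map (\<lambda>i. replicate (card (gens p nu i)) (p ^ (i + e - 1))) [1..<n + 1]"
    by (rule map_cong) (auto simp: s)
  then have "(\<forall>i\<in>{1..n}. s i \<ge> 0) \<and> l \<ge> 0 \<and>
    (\<exists>L. internal_direct_product (normalized_units G (p ^ e)) (gr_basis G (p ^ e) ` carrier G) L \<and>
         normalized_units G (p ^ e)\<lparr>carrier := L\<rparr> \<cong>
           cyclic_product (replicate (nat l) (p ^ (e - 1)) @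
             concat (map (\<lambda>i. replicate (nat (s i)) (p ^ (i + e - 1))) [1..<n + 1])))"
    using U.splitting s by (simp only: l nat_int) simp
  then show ?thesis
    unfolding Let_def l_def s_def t_def .
qed

end
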